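(* Let $n\ge2$, let $p$ be a prime, let $G=SD_{8n}\le S_{4n}$, and let $V$ be a finite-dimensional complex inner product space with $\dim V>2$. Let $\epsilon=3$ if $p\ne2$ and $n$ is even, $\epsilon=7$ if $p\neq2$ and $n$ is odd, and $\epsilon=1$ if $p=2$. Let $0\le j\le\epsilon$ and let $\phi=\hat\chi_j$ (if $n$ is even) or $\phi=\hat\chi'_j$ (if $n$ is odd). Then the space $V_\phi(G)$ has an o-basis if and only if $p=2$ or $4n$ is not divisible by $p$.
   Context: The semi-dihedral group is $SD_{8n}=\langle a,b\mid a^{4n}=b^2=e,\ bab=a^{2n-1}\rangle=\{a^i,ba^i:0\le i<4n\}$, embedded in $S_{4n}$ by $a\mapsto(t\mapsto\overline{t+1})$ and $b\mapsto(t\mapsto\overline{(2n-1)t})$, where $\overline{x}$ denotes reduction modulo $4n$ (residue $0$ identified with the point $4n$). Linear characters, determined by their values on $(a,b)$: for $n$ even, $\chi_0=(1,1)$, $\chi_1=(1,-1)$, $\chi_2=(-1,1)$, $\chi_3=(-1,-1)$; for $n$ odd, $\chi'_0=(1,1)$, $\chi'_1=(1,-1)$, $\chi'_2=(-1,1)$, $\chi'_3=(-1,-1)$, $\chi'_4=(i,1)$, $\chi'_5=(i,-1)$, $\chi'_6=(-i,1)$, $\chi'_7=(-i,-1)$. $\hat G$ is the set of $p$-regular elements of $G$ (order not divisible by $p$), and $\hat\chi_j=\chi_j|_{\hat G}$, $\hat\chi'_j=\chi'_j|_{\hat G}$. Symmetry classes: for $G\le S_m$ (here $m=4n$), let $\{e_1,\dots,e_k\}$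 be an orthonormal basis of $V$, $k=\dim V$; $\Gamma^m_k$ is the set of sequences $\alpha=(\alpha_1,\dots,\alpha_m)$ with $1\le\alpha_i\le k$; $\alpha\sigma=(\alpha_{\sigma(1)},\dots,\alpha_{\sigma(m)})$ for $\sigma\in G$; $e_\alpha=e_{\alpha_1}\otimes\cdots\otimes e_{\alpha_m}$; $V^{\otimes m}$ has the induced inner product, for which the $e_\alpha$ are orthonormal. For $\phi:S\to\mathbb{C}$ (here $S=\hat G$), $$e^\phi_\alpha=\frac{\phi(e)}{|S|}\sum_{\sigma\in S}\phi(\sigma)e_{\alpha\sigma^{-1}},\qquad V_\phi(G)=\operatorname{span}\{e^\phi_\alpha:\alpha\in\Gamma^m_k\}.$$ An o-basis of a subspace $W\subseteq V_\phi(G)$ is an orthogonal basis of $W$ of the form $\{e^\phi_{\alpha_1},\dots,e^\phi_{\alpha_t}\}$ with $\alpha_i\in\Gamma^m_k$; the empty set is an o-basis of the zero subspace. *)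

theory Defs
  imports
    Complex_Main
    "HOL-Library.FuncSet"
    "HOL-Library.Function_Algebras"
    "HOL-Computational_Algebra.Primes"
    "HOL-Algebra.Sym_Groups"
    "HOL-Algebra.Multiplicative_Group"
begin

section \<open>Semi-dihedral groups and their linear characters\<close>

text \<open>The representative of a residue class modulo \<open>m\<close> in \<open>{1..m}\<close>.\<close>

definition red :: "nat \<Rightarrow> nat \<Rightarrow> nat" where
  "red m x = (if x mod m = 0 then m else x mod m)"

definition sd_a :: "nat \<Rightarrow> nat \<Rightarrow> nat" where
  "sd_a n t = (if t \<in> {1..4*n} then red (4*n) (t + 1) else t)"

definition sd_b :: "nat \<Rightarrow> nat \<Rightarrow> nat" where
  "sd_b n t = (if t \<in> {1..4*n} then red (4*n) ((2*n - 1) * t) else t)"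

text \<open>\<open>SD n\<close> is the semi-dihedral group of order \<open>8n\<close>, as a subgroup of the symmetric group
  on \<open>{1..4n}\<close>. The defining relations and the normal form of its elements are proved below.\<close>

definition SD :: "nat \<Rightarrow> (nat \<Rightarrow> nat) monoid" where
  "SD n = (sym_group (4*n)) \<lparr> carrier := generate (sym_group (4*n)) {sd_a n, sd_b n} \<rparr>"

definition p_regular :: "nat \<Rightarrow> ('a, 'b) monoid_scheme \<Rightarrow> 'a set" where
  "p_regular p G = {x \<in> carrier G. \<not> p dvd group.ord G x}"

definition linear_character :: "('a, 'b) monoid_scheme \<Rightarrow> ('a \<Rightarrow> complex) \<Rightarrow> bool" where
  "linear_character G \<chi> \<longleftrightarrow> \<chi> \<in> hom G \<lparr> carrier = UNIV - {0}, mult = (*), one = 1 \<rparr>"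

text \<open>The values on \<open>(a, b)\<close> of the \<open>j\<close>-th linear character; \<open>j \<le> 3\<close> for even \<open>n\<close>
  and \<open>j \<le> 7\<close> for odd \<open>n\<close>.\<close>

definition sd_char_values :: "nat \<Rightarrow> nat \<Rightarrow> complex \<times> complex" where
  "sd_char_values n j =
     (if even n then [(1, 1), (1, -1), (-1, 1), (-1, -1)] ! j
      else [(1, 1), (1, -1), (-1, 1), (-1, -1), (\<i>, 1), (\<i>, -1), (-\<i>, 1), (-\<i>, -1)] ! j)"

definition is_sd_char :: "nat \<Rightarrow> nat \<Rightarrow> ((nat \<Rightarrow> nat) \<Rightarrow> complex) \<Rightarrow> bool" where
  "is_sd_char n j \<chi> \<longleftrightarrow>
     linear_character (SD n) \<chi> \<and> (\<chi> (sd_a n), \<chi> (sd_b n)) = sd_char_values n j"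

definition sd_eps :: "nat \<Rightarrow> nat \<Rightarrow> nat" where
  "sd_eps p n = (if p = 2 then 1 else if even n then 3 else 7)"

section \<open>Complex inner product spaces and their tensor powers\<close>

text \<open>The inner product is linear in its first argument.\<close>

locale complex_inner_space = vector_space scale
  for scale :: "complex \<Rightarrow> 'v::ab_group_add \<Rightarrow> 'v" +
  fixes ip :: "'v \<Rightarrow> 'v \<Rightarrow> complex"
  assumes ip_add: "ip (x + y) z = ip x z + ip y z"
    and ip_scale: "ip (scale c x) y = c * ip x y"
    and ip_commute: "ip y x = cnj (ip x y)"
    and ip_pos: "x \<noteq> 0 \<Longrightarrow> 0 < Re (ip x x)"

definition orthonormal_basis ::
  "(complex \<Rightarrow> 'v::ab_group_add \<Rightarrow> 'v) \<Rightarrow> ('v \<Rightarrow> 'v \<Rightarrow> complex) \<Rightarrow> nat \<Rightarrow> (nat \<Rightarrow> 'v) \<Rightarrow> bool" where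
  "orthonormal_basis scale ip k e \<longleftrightarrow>
     (\<forall>i\<in>{1..k}. \<forall>j\<in>{1..k}. ip (e i) (e j) = (if i = j then 1 else 0)) \<and>
     module.span scale (e ` {1..k}) = UNIV"

text \<open>The \<open>m\<close>-th tensor power of a finite-dimensional inner product space is realised as the space
  of forms in \<open>m\<close> variables (indexed by \<open>{1..m}\<close>) that are conjugate-linear in each variable:
  \<open>x\<^sub>1 \<otimes> \<dots> \<otimes> x\<^sub>m\<close> is the form \<open>(y\<^sub>1, \<dots>, y\<^sub>m) \<mapsto> \<langle>x\<^sub>1, y\<^sub>1\<rangle> \<cdots> \<langle>x\<^sub>m, y\<^sub>m\<rangle>\<close>.\<close>

type_synonym 'v tensor = "(nat \<Rightarrow> 'v) \<Rightarrow> complex"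

definition tscale :: "complex \<Rightarrow> 'v tensor \<Rightarrow> 'v tensor" where
  "tscale c T = (\<lambda>y. c * T y)"

definition pure_tensor :: "('v \<Rightarrow> 'v \<Rightarrow> complex) \<Rightarrow> nat \<Rightarrow> (nat \<Rightarrow> 'v) \<Rightarrow> 'v tensor" where
  "pure_tensor ip m x = (\<lambda>y. \<Prod>i\<in>{1..m}. ip (x i) (y i))"

definition seqs :: "nat \<Rightarrow> nat \<Rightarrow> (nat \<Rightarrow> nat) set" where
  "seqs m k = {1..m} \<rightarrow>\<^sub>E {1..k}"

text \<open>Since \<open>T (e \<circ> \<alpha>)\<close> is the coordinate of \<open>T\<close> at \<open>e\<^sub>\<alpha>\<close>, this is the inner product that
  makes the \<open>e\<^sub>\<alpha>\<close> orthonormal; \<open>tensor_ip_pure\<close> below shows that it is the induced one.\<close>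

definition tensor_ip ::
  "(nat \<Rightarrow> 'v) \<Rightarrow> nat \<Rightarrow> nat \<Rightarrow> 'v tensor \<Rightarrow> 'v tensor \<Rightarrow> complex" where
  "tensor_ip e k m T U = (\<Sum>\<alpha>\<in>seqs m k. T (e \<circ> \<alpha>) * cnj (U (e \<circ> \<alpha>)))"

section \<open>Symmetry classes of tensors and o-bases\<close>

definition basis_tensor ::
  "('v \<Rightarrow> 'v \<Rightarrow> complex) \<Rightarrow> (nat \<Rightarrow> 'v) \<Rightarrow> nat \<Rightarrow> (nat \<Rightarrow> nat) \<Rightarrow> 'v tensor" where
  "basis_tensor ip e m \<alpha> = pure_tensor ip m (e \<circ> \<alpha>)"

definition sym_tensor ::
  "('v \<Rightarrow> 'v \<Rightarrow> complex) \<Rightarrow> (nat \<Rightarrow> 'v) \<Rightarrow> nat \<Rightarrow> (nat \<Rightarrow> nat) set \<Rightarrow> ((nat \<Rightarrow> nat) \<Rightarrow> complex)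
     \<Rightarrow> (nat \<Rightarrow> nat) \<Rightarrow> 'v tensor" where
  "sym_tensor ip e m S \<phi> \<alpha> =
     tscale (\<phi> id / of_nat (card S))
       (\<Sum>\<sigma>\<in>S. tscale (\<phi> \<sigma>) (basis_tensor ip e m (\<alpha> \<circ> inv' \<sigma>)))"

definition symmetry_class ::
  "('v \<Rightarrow> 'v \<Rightarrow> complex) \<Rightarrow> nat \<Rightarrow> (nat \<Rightarrow> 'v) \<Rightarrow> nat \<Rightarrow> (nat \<Rightarrow> nat) set
     \<Rightarrow> ((nat \<Rightarrow> nat) \<Rightarrow> complex) \<Rightarrow> 'v tensor set" where
  "symmetry_class ip k e m S \<phi> = module.span tscale (sym_tensor ip e m S \<phi> ` seqs m k)"

definition o_basis ::
  "('v \<Rightarrow> 'v \<Rightarrow> complex) \<Rightarrow> nat \<Rightarrow> (nat \<Rightarrow> 'v) \<Rightarrow> nat \<Rightarrow> (nat \<Rightarrow> nat) set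
     \<Rightarrow> ((nat \<Rightarrow> nat) \<Rightarrow> complex) \<Rightarrow> 'v tensor set \<Rightarrow> 'v tensor set \<Rightarrow> bool" where
  "o_basis ip k e m S \<phi> W B \<longleftrightarrow>
     B \<subseteq> sym_tensor ip e m S \<phi> ` seqs m k \<and>
     \<not> module.dependent tscale B \<and> module.span tscale B = W \<and>
     (\<forall>u\<in>B. \<forall>v\<in>B. u \<noteq> v \<longrightarrow> tensor_ip e k m u v = 0)"

section \<open>Basic properties of the definitions\<close>

lemma red_mod [simp]: "red m x mod m = x mod m"
  by (simp add: red_def)

lemma red_in: "m > 0 \<Longrightarrow> red m x \<in> {1..m}"
  by (auto simp: red_def less_imp_le Suc_le_eq)

lemma red_cong: "x mod m = y mod m \<Longrightarrow> red m x = red m y"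
  by (simp add: red_def)

lemma red_self: "t \<in> {1..m} \<Longrightarrow> red m t = t"
  by (cases "t = m") (auto simp: red_def)

definition aff :: "nat \<Rightarrow> nat \<Rightarrow> nat \<Rightarrow> nat \<Rightarrow> nat" where
  "aff m s c t = (if t \<in> {1..m} then red m (s * t + c) else t)"

lemma aff_comp:
  assumes "m > 0"
  shows "aff m s c \<circ> aff m s' c' = aff m (s * s') (s * c' + c)"
proof
  fix t
  show "(aff m s c \<circ> aff m s' c') t = aff m (s * s') (s * c' + c) t"
  proof (cases "t \<in> {1..m}")
    case True
    have "(s * red m (s' * t + c') + c) mod m = (s * (s' * t + c') + c) mod m"
      by (metis mod_add_left_eq mod_mult_right_eq red_mod)
    then have "red m (s * red m (s' * t + c') + c) = red m (s * s' * t + (s * c' + c))"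
      by (intro red_cong) (simp add: algebra_simps)
    with True red_in[OF assms] show ?thesis by (simp add: aff_def)
  qed (auto simp: aff_def)
qed

lemma aff_id: "aff m 1 0 = id"
proof
  fix t
  have "red m (1 * t + 0) = t" if "t \<in> {1..m}"
    using red_self[OF that] by (simp only: mult_1_left add_0_right)
  then show "aff m 1 0 t = id t"
    unfolding aff_def id_apply by presburger
qed

lemma aff_cong:
  assumes "s mod m = s' mod m" "c mod m = c' mod m"
  shows "aff m s c = aff m s' c'"
proof
  fix t
  have "(s * t + c) mod m = (s' * t + c') mod m"
    by (rule mod_add_cong[OF mod_mult_cong[OF assms(1) refl] assms(2)])
  then show "aff m s c t = aff m s' c' t"
    unfolding aff_def using red_cong[of "s * t + c" m "s' * t + c'"] by presburger
qed

lemma sd_a_aff: "sd_a n = aff (4*n) 1 1"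
  and sd_b_aff: "sd_b n = aff (4*n) (2*n - 1) 0"
  by (auto simp: sd_a_def sd_b_def aff_def)

lemma sd_sq:
  fixes n :: nat
  assumes "n \<ge> 1"
  shows "((2*n - 1) * (2*n - 1)) mod (4*n) = 1 mod (4*n)"
proof -
  have "(2*n - 1) * (2*n - 1) = 1 + 4*n * (n - 1)"
    using assms by (cases n) (auto simp: algebra_simps)
  then show ?thesis by (simp only: mod_mult_self2)
qed

lemma sd_a_pow:
  assumes "n \<ge> 1"
  shows "sd_a n ^^ i = aff (4*n) 1 i"
proof (induction i)
  case 0
  show ?case by (simp only: funpow.simps aff_id)
next
  case (Suc i)
  then show ?case using assms by (simp add: sd_a_aff aff_comp)
qed

lemma aff_sd_sq:
  assumes "n \<ge> 1"
  shows "aff (4*n) ((2*n - 1) * (2*n - 1)) c = aff (4*n) 1 c"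
  by (rule aff_cong) (simp_all only: sd_sq[OF assms])

theorem sd_relations:
  assumes "n \<ge> 1"
  shows "sd_a n ^^ (4*n) = id" "sd_b n \<circ> sd_b n = id"
    "sd_b n \<circ> sd_a n \<circ> sd_b n = sd_a n ^^ (2*n - 1)"
proof -
  let ?s = "2*n - 1"
  have pos: "4*n > 0" using assms by simp
  have "aff (4*n) 1 (4*n) = aff (4*n) 1 0"
    by (rule aff_cong) simp_all
  then show "sd_a n ^^ (4*n) = id"
    unfolding sd_a_pow[OF assms] aff_id .
  note sq = aff_sd_sq[OF assms]
  show "sd_b n \<circ> sd_b n = id"
    unfolding sd_b_aff aff_comp[OF pos] sq mult_0_right add_0_right aff_id ..
  show "sd_b n \<circ> sd_a n \<circ> sd_b n = sd_a n ^^ ?s"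
    unfolding sd_a_pow[OF assms]
    unfolding sd_b_aff sd_a_aff aff_comp[OF pos] mult_1_right mult_0_right
      add_0_right add_0_left sq ..
qed

lemma aff_funs_permutes:
  assumes "m > 0" "f \<circ> aff m s c = id" "aff m s c \<circ> f = id"
  shows "aff m s c permutes {1..m}"
proof -
  have "bij (aff m s c)" by (rule o_bij[OF assms(2,3)])
  then have "\<exists>!x. aff m s c x = y" for y by (simp add: bij_iff)
  moreover have "aff m s c x = x" if "x \<notin> {1..m}" for x
    using that by (simp only: aff_def if_False)
  ultimately show ?thesis unfolding permutes_def by blast
qed

lemma
  assumes "n \<ge> 1"
  shows sd_a_permutes: "sd_a n permutes {1..4*n}"
    and sd_b_permutes: "sd_b n permutes {1..4*n}"
    and inv_sd_a: "inv' (sd_a n) = sd_a n ^^ (4*n - 1)"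
    and inv_sd_b: "inv' (sd_b n) = sd_b n"
proof -
  have Suc: "Suc (4*n - 1) = 4*n" and pos: "4*n > 0" using assms by simp_all
  have a: "sd_a n ^^ (4*n - 1) \<circ> sd_a n = id" "sd_a n \<circ> sd_a n ^^ (4*n - 1) = id"
    unfolding funpow_Suc_right[symmetric] funpow.simps(2)[symmetric] Suc
    by (rule sd_relations(1)[OF assms])+
  note b = sd_relations(2)[OF assms]
  show "sd_a n permutes {1..4*n}"
    using aff_funs_permutes[OF pos] a unfolding sd_a_aff by blast
  show "sd_b n permutes {1..4*n}"
    using aff_funs_permutes[OF pos] b unfolding sd_b_aff by blast
  show "inv' (sd_a n) = sd_a n ^^ (4*n - 1)"
    by (rule inv_unique_comp) (rule a)+
  show "inv' (sd_b n) = sd_b n"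
    by (rule inv_unique_comp) (rule b)+
qed

theorem SD_carrier:
  assumes "n \<ge> 1"
  shows "carrier (SD n) = {sd_a n ^^ i | i. i < 4*n} \<union> {sd_b n \<circ> sd_a n ^^ i | i. i < 4*n}"
proof -
  define m where "m = 4*n"
  define s where "s = 2*n - 1"
  define H where "H = generate (sym_group m) {sd_a n, sd_b n}"
  have pos: "m > 0" using assms by (simp add: m_def)
  have a: "sd_a n = aff m 1 1" and b: "sd_b n = aff m s 0" and pow: "sd_a n ^^ i = aff m 1 i"
    and sq: "aff m (s * s) c = aff m 1 c" for i c
    using sd_a_aff sd_b_aff sd_a_pow[OF assms] aff_sd_sq[OF assms] by (simp_all only: m_def s_def)
  have b_pow: "sd_b n \<circ> sd_a n ^^ i = aff m s (s * i)" for i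
    unfolding pow b aff_comp[OF pos] by (simp only: mult_1_right add_0_right)
  have carr: "sd_a n \<in> carrier (sym_group m)" "sd_b n \<in> carrier (sym_group m)"
    using sd_a_permutes[OF assms] sd_b_permutes[OF assms] by (simp_all only: sym_group_carrier m_def)
  have H_aff: "\<exists>c. f = aff m 1 c \<or> f = aff m s c" if "f \<in> H" for f
    using that unfolding H_def
  proof (induction rule: generate.induct)
    case one
    have "\<one>\<^bsub>sym_group m\<^esub> = aff m 1 0" by (simp only: sym_group_one aff_id)
    then show ?case by blast
  next
    case (incl h)
    with a b show ?case by blast
  next
    case (inv h)
    then consider "h = sd_a n" | "h = sd_b n" by blast
    then show ?case
    proof cases
      case 1
      then have "inv\<^bsub>sym_group m\<^esub> h = aff m 1 (m - 1)"
        by (simp only: sym_group_inv_equality carr inv_sd_a[OF assms] pow) (simp only: m_def)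
      then show ?thesis by blast
    next
      case 2
      then have "inv\<^bsub>sym_group m\<^esub> h = aff m s 0"
        by (simp only: sym_group_inv_equality carr inv_sd_b[OF assms] b[symmetric])
      then show ?thesis by blast
    qed
  next
    case (eng h1 h2)
    then obtain c d where "h1 = aff m 1 c \<or> h1 = aff m s c" "h2 = aff m 1 d \<or> h2 = aff m s d"
      by blast
    then show ?case
      unfolding sym_group_mult
      using aff_comp[OF pos, of 1 c 1 d] aff_comp[OF pos, of 1 c s d] aff_comp[OF pos, of s c 1 d]
        aff_comp[OF pos, of s c s d, unfolded sq] unfolding mult_1_left mult_1_right by metis
  qed
  have "f \<in> {sd_a n ^^ i | i. i < m} \<union> {sd_b n \<circ> sd_a n ^^ i | i. i < m}" if f: "f \<in> H" for f
  proof -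
    obtain c where "f = aff m 1 c \<or> f = aff m s c" using H_aff[OF f] by blast
    then show ?thesis
    proof
      assume "f = aff m 1 c"
      also have "\<dots> = sd_a n ^^ (c mod m)"
        unfolding pow by (rule aff_cong) simp_all
      finally show ?thesis using mod_less_divisor[OF pos, of c] by blast
    next
      assume fs: "f = aff m s c"
      have ss: "s * s mod m = 1 mod m"
        unfolding m_def s_def by (rule sd_sq[OF assms])
      have "s * (s * c mod m) mod m = s * s * c mod m"
        by (simp only: mod_mult_right_eq mult.assoc)
      also have "\<dots> = 1 * c mod m"
        by (rule mod_mult_cong[OF ss refl])
      also have "\<dots> = c mod m"
        by (simp only: mult_1_left)
      finally have "aff m s c = aff m s (s * (s * c mod m))"
        by (intro aff_cong refl) (rule sym)
      then have "f = sd_b n \<circ> sd_a n ^^ (s * c mod m)"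
        unfolding fs b_pow .
      then show ?thesis using mod_less_divisor[OF pos, of "s * c"] by blast
    qed
  qed
  moreover have comp_H: "f \<circ> g \<in> H" if "f \<in> {sd_a n, sd_b n}" "g \<in> H" for f g
    using generate.eng[OF generate.incl that(2)[unfolded H_def]] that(1)
    unfolding sym_group_mult H_def by blast
  moreover have pow_H: "sd_a n ^^ i \<in> H" for i
  proof (induction i)
    case 0
    show ?case using generate.one[of "sym_group m"] by (simp only: sym_group_one H_def funpow.simps)
  next
    case (Suc i)
    then show ?case unfolding funpow.simps by (intro comp_H) simp_all
  qed
  moreover have "carrier (SD n) = H" by (simp add: SD_def H_def m_def)
  ultimately show ?thesis unfolding m_def by auto
qed

theorem SD_subgroup:
  assumes "n \<ge> 1"
  shows "subgroup (carrier (SD n)) (sym_group (4*n))" "group (SD n)"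
proof -
  interpret group "sym_group (4*n)" by (rule sym_group_is_group)
  have "subgroup (generate (sym_group (4*n)) {sd_a n, sd_b n}) (sym_group (4*n))"
    using sd_a_permutes sd_b_permutes assms
    by (intro generate_is_subgroup) (auto simp: sym_group_carrier)
  then show "subgroup (carrier (SD n)) (sym_group (4*n))" "group (SD n)"
    using subgroup_imp_group by (simp_all add: SD_def)
qed

lemma aff_eq_imp:
  assumes "m > 1" "aff m s c = aff m s' c'"
  shows "s mod m = s' mod m" "c mod m = c' mod m"
proof -
  have *: "(s * t + c) mod m = (s' * t + c') mod m" if "t \<in> {1..m}" for t
    using fun_cong[OF assms(2), of t] that by (metis aff_def red_mod)
  show c: "c mod m = c' mod m"
    using *[of m] assms(1) by simp
  have "(s + c) mod m = (s' + c') mod m"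
    using *[of 1] assms(1) by simp
  then have "(int s + int c) mod int m = (int s' + int c') mod int m" "int c mod int m = int c' mod int m"
    using c by (simp_all only: of_nat_mod[symmetric] of_nat_add[symmetric])
  then have "(int s + int c - int c) mod int m = (int s' + int c' - int c') mod int m"
    by (rule mod_diff_cong)
  then show "s mod m = s' mod m"
    by (simp only: add_diff_cancel_right' of_nat_mod[symmetric] of_nat_eq_iff)
qed

lemma sd_slope_neq:
  fixes n :: nat
  assumes "n \<ge> 2"
  shows "1 mod (4*n) \<noteq> (2*n - 1) mod (4*n)"
  using assms by simp

theorem SD_order:
  assumes "n \<ge> 2"
  shows "order (SD n) = 8*n"
proof -
  let ?A = "(\<lambda>i. sd_a n ^^ i) ` {..<4*n}" and ?B = "(\<lambda>i. sd_b n \<circ> sd_a n ^^ i) ` {..<4*n}"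
  have n: "n \<ge> 1" "4*n > 0" "4*n > 1" using assms by auto
  note pow = sd_a_pow[OF n(1)]
  have inj: "inj_on (\<lambda>i. sd_a n ^^ i) {..<4*n}"
  proof (rule inj_onI)
    fix i j assume ij: "i \<in> {..<4*n}" "j \<in> {..<4*n}" "sd_a n ^^ i = sd_a n ^^ j"
    from aff_eq_imp(2)[OF n(3) ij(3)[unfolded pow]] ij(1,2) show "i = j" by simp
  qed
  have "inj_on (\<lambda>i. sd_b n \<circ> sd_a n ^^ i) {..<4*n}"
  proof (rule inj_onI)
    fix i j assume ij: "i \<in> {..<4*n}" "j \<in> {..<4*n}" "sd_b n \<circ> sd_a n ^^ i = sd_b n \<circ> sd_a n ^^ j"
    then have "sd_b n \<circ> (sd_b n \<circ> sd_a n ^^ i) = sd_b n \<circ> (sd_b n \<circ> sd_a n ^^ j)"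
      by simp
    then have "sd_a n ^^ i = sd_a n ^^ j"
      by (simp only: o_assoc sd_relations(2)[OF n(1)] id_o)
    then show "i = j" using inj_onD[OF inj _ ij(1,2)] by blast
  qed
  with inj have "card ?A = 4*n" "card ?B = 4*n"
    by (simp_all add: card_image)
  moreover have "?A \<inter> ?B = {}"
  proof -
    have False if "sd_a n ^^ i = sd_b n \<circ> sd_a n ^^ j" for i j
    proof -
      have "aff (4*n) 1 i = aff (4*n) (2*n - 1) ((2*n - 1) * j)"
        using that unfolding pow sd_b_aff aff_comp[OF n(2)] by simp
      from aff_eq_imp(1)[OF n(3) this] sd_slope_neq[OF assms] show False by simp
    qed
    then show ?thesis by blast
  qed
  moreover have "carrier (SD n) = ?A \<union> ?B"
    unfolding SD_carrier[OF n(1)] by auto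
  ultimately show ?thesis by (simp add: order_def card_Un_disjoint)
qed

theorem is_sd_char_exists:
  assumes "n \<ge> 2" "j \<le> (if even n then 3 else 7)"
  shows "\<exists>\<chi>. is_sd_char n j \<chi>"
proof -
  let ?m = "4*n" and ?s = "2*n - 1"
  have n: "n \<ge> 1" "?m > 0" "?m > 1" using assms by auto
  obtain u v where uv: "sd_char_values n j = (u, v)" by fastforce
  have "j \<in> (if even n then {0,1,2,3} else {0,1,2,3,4,5,6,7})"
    using assms(2) by (auto split: if_splits)
  then have "(u, v) \<in> (if even n then {1,-1} else {1,-1,\<i>,-\<i>}) \<times> {1,-1}"
    using uv unfolding sd_char_values_def by (auto split: if_splits)
  then have v: "v * v = 1" and u4: "u ^ 4 = 1" and u: "u \<noteq> 0" "v \<noteq> 0"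
    and u2: "even n \<Longrightarrow> u ^ 2 = 1"
    by (auto simp: power4_eq_xxxx split: if_splits)
  have um: "u ^ ?m = 1" using u4 by (simp add: power_mult)
  have ucong: "u ^ x = u ^ (x mod ?m)" for x
    by (metis mult_div_mod_eq power_add power_mult power_one um mult_1)
  have us: "u ^ ?s = u"
  proof -
    have "u ^ (2 * (n - 1)) = 1"
    proof (cases "even n")
      case True then show ?thesis using u2 by (simp add: power_mult)
    next
      case False
      then obtain q where "n - 1 = 2 * q" by (auto elim!: oddE)
      then show ?thesis using u4 by (simp add: power_mult)
    qed
    moreover have "?s = Suc (2 * (n - 1))" using n by simp
    ultimately show ?thesis by simp
  qed
  define sgn where "sgn s = (if s mod ?m = 1 mod ?m then 1 else v)" for s
  define \<chi> where "\<chi> f = (let (s, c) = SOME (s, c). f = aff ?m s c in sgn s * u ^ c)" for f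
  have \<chi>: "\<chi> (aff ?m s c) = sgn s * u ^ c" for s c
  proof -
    obtain s' c' where sc: "(SOME (s', c'). aff ?m s c = aff ?m s' c') = (s', c')" by fastforce
    have "case (SOME (s', c'). aff ?m s c = aff ?m s' c') of (s', c') \<Rightarrow> aff ?m s c = aff ?m s' c'"
      by (rule someI[of _ "(s, c)"]) simp
    then have "aff ?m s c = aff ?m s' c'" unfolding sc by simp
    from aff_eq_imp[OF n(3) this] have "s mod ?m = s' mod ?m" "c mod ?m = c' mod ?m" .
    then have "sgn s = sgn s'" "u ^ c = u ^ c'"
      using ucong[of c] ucong[of c'] unfolding sgn_def by presburger+
    then show ?thesis by (simp add: \<chi>_def sc)
  qed
  have car: "\<exists>s\<in>{1, ?s}. \<exists>c. f = aff ?m s c" if "f \<in> carrier (SD n)" for f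
  proof -
    from that obtain i where "f = sd_a n ^^ i \<or> f = sd_b n \<circ> sd_a n ^^ i"
      unfolding SD_carrier[OF n(1)] by blast
    then show ?thesis
      unfolding sd_a_pow[OF n(1)] sd_b_aff aff_comp[OF n(2)] mult_1_right by blast
  qed
  have sgn: "sgn 1 = 1" "sgn ?s = v" "sgn (?s * ?s) = 1"
    unfolding sgn_def using sd_sq[OF n(1)] sd_slope_neq[OF assms(1)] by presburger+
  have sgn_mult: "sgn (s * s') = sgn s * sgn s'" if "s \<in> {1, ?s}" "s' \<in> {1, ?s}" for s s'
  proof -
    from that consider "s = 1" | "s' = 1" | "s = ?s \<and> s' = ?s" by blast
    then show ?thesis
      by cases (simp_all only: sgn v mult_1_left mult_1_right)
  qed
  have "linear_character (SD n) \<chi>"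
    unfolding linear_character_def
  proof (rule homI)
    fix f assume "f \<in> carrier (SD n)"
    with car obtain s c where "f = aff ?m s c" by blast
    then show "\<chi> f \<in> carrier \<lparr>carrier = UNIV - {0}, mult = (*), one = 1\<rparr>"
      using u by (simp add: \<chi> sgn_def)
  next
    fix f g assume "f \<in> carrier (SD n)" "g \<in> carrier (SD n)"
    with car obtain s c s' c' where *: "f = aff ?m s c" "g = aff ?m s' c'" "s \<in> {1, ?s}" "s' \<in> {1, ?s}"
      by metis
    have "sgn (s * s') = sgn s * sgn s'"
      using sgn_mult *(3,4) by blast
    moreover have "u ^ (s * c' + c) = u ^ c * u ^ c'"
    proof -
      have "u ^ (s * c') = u ^ c'"
        unfolding power_mult using *(3) us power_one_right[of u] by (elim insertE) (simp_all only: empty_iff)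
      then show ?thesis by (simp only: power_add mult.commute)
    qed
    moreover have "f \<otimes>\<^bsub>SD n\<^esub> g = aff ?m (s * s') (s * c' + c)"
      by (simp add: SD_def sym_group_mult * aff_comp[OF n(2)])
    ultimately show "\<chi> (f \<otimes>\<^bsub>SD n\<^esub> g) = \<chi> f \<otimes>\<^bsub>\<lparr>carrier = UNIV - {0}, mult = (*), one = 1\<rparr>\<^esub> \<chi> g"
      by (simp add: \<chi> *(1,2))
  qed
  moreover have "(\<chi> (sd_a n), \<chi> (sd_b n)) = (u, v)"
    unfolding sd_a_aff sd_b_aff \<chi> sgn by simp
  ultimately show ?thesis unfolding is_sd_char_def uv by blast
qed

lemma tscale_vector_space: "vector_space tscale"
  by unfold_locales (auto simp: tscale_def algebra_simps)

context complex_inner_space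
begin

lemma ip_zero: "ip 0 y = 0"
  using ip_scale[of 0 0 y] by simp

lemma ip_sum: "ip (\<Sum>i\<in>I. f i) y = (\<Sum>i\<in>I. ip (f i) y)"
  by (induction I rule: infinite_finite_induct) (auto simp: ip_zero ip_add)

lemma parseval:
  assumes "orthonormal_basis scale ip k e"
  shows "(\<Sum>i\<in>{1..k}. ip x (e i) * cnj (ip y (e i))) = ip x y"
proof -
  have on: "ip (e i) (e j) = (if i = j then 1 else 0)" if "i \<in> {1..k}" "j \<in> {1..k}" for i j
    using assms that unfolding orthonormal_basis_def by blast
  have x: "x \<in> span (e ` {1..k})" using assms unfolding orthonormal_basis_def by simp
  then show ?thesis
  proof (induction rule: span_induct_alt)
    case base
    show ?case by (simp add: ip_zero)
  next
    case (step c z w)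
    then obtain j where j: "j \<in> {1..k}" "z = e j" by blast
    have "(\<Sum>i\<in>{1..k}. ip z (e i) * cnj (ip y (e i))) = (\<Sum>i\<in>{1..k}. if i = j then cnj (ip y (e i)) else 0)"
      using on[OF j(1)] j(2) by (intro sum.cong) auto
    also have "\<dots> = ip z y" using j ip_commute[of z y] by (simp add: ip_commute[of "e j" y])
    finally have "(\<Sum>i\<in>{1..k}. ip z (e i) * cnj (ip y (e i))) = ip z y" .
    with step(2) show ?case
      by (simp add: ip_add ip_scale distrib_right sum.distrib mult.assoc flip: sum_distrib_left)
  qed
qed

theorem tensor_ip_pure:
  assumes "orthonormal_basis scale ip k e"
  shows "tensor_ip e k m (pure_tensor ip m x) (pure_tensor ip m y) = (\<Prod>i\<in>{1..m}. ip (x i) (y i))"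
proof -
  have "tensor_ip e k m (pure_tensor ip m x) (pure_tensor ip m y) =
      (\<Sum>\<alpha>\<in>{1..m} \<rightarrow>\<^sub>E {1..k}. \<Prod>i\<in>{1..m}. ip (x i) (e (\<alpha> i)) * cnj (ip (y i) (e (\<alpha> i))))"
    by (simp add: tensor_ip_def pure_tensor_def seqs_def prod.distrib)
  also have "\<dots> = (\<Prod>i\<in>{1..m}. \<Sum>j\<in>{1..k}. ip (x i) (e j) * cnj (ip (y i) (e j)))"
    by (rule prod_sum_PiE[symmetric]) auto
  finally show ?thesis using parseval[OF assms] by simp
qed

theorem basis_tensor_orthonormal:
  assumes "orthonormal_basis scale ip k e" "\<alpha> \<in> seqs m k" "\<beta> \<in> seqs m k"
  shows "tensor_ip e k m (basis_tensor ip e m \<alpha>) (basis_tensor ip e m \<beta>) = (if \<alpha> = \<beta> then 1 else 0)"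
proof -
  have on: "ip (e i) (e j) = (if i = j then 1 else 0)" if "i \<in> {1..k}" "j \<in> {1..k}" for i j
    using assms that unfolding orthonormal_basis_def by blast
  have "ip (e (\<alpha> i)) (e (\<beta> i)) = (if \<alpha> i = \<beta> i then 1 else 0)" if "i \<in> {1..m}" for i
    using assms(2,3) that unfolding seqs_def by (intro on) auto
  then have "tensor_ip e k m (basis_tensor ip e m \<alpha>) (basis_tensor ip e m \<beta>) =
      (\<Prod>i\<in>{1..m}. if \<alpha> i = \<beta> i then 1 else 0)"
    by (simp add: basis_tensor_def tensor_ip_pure[OF assms(1)])
  also have "\<dots> = (if \<alpha> = \<beta> then 1 else 0)"
  proof (cases "\<alpha> = \<beta>")
    case False
    then obtain i where "i \<in> {1..m}" "\<alpha> i \<noteq> \<beta> i"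
      using assms(2,3) unfolding seqs_def by (metis PiE_ext)
    then show ?thesis using False by (auto simp: prod_zero_iff)
  qed simp
  finally show ?thesis .
qed

end

end

theory Submission
  imports Defs "HOL-Number_Theory.Cong"
begin

text \<open>
  Everything depends on the set \<open>S\<close> of \<open>p\<close>-regular elements of \<open>G = SD n\<close>, and on two general facts
  about a permutation group \<open>G\<close> with a linear character \<open>\<chi>\<close>.

  If \<open>S\<close> is itself a group, then \<open>e\<^sub>\<alpha>\<^sub>\<tau>\<close> is a scalar multiple of \<open>e\<^sub>\<alpha>\<close> for \<open>\<tau> \<in> S\<close>
  (here \<open>e\<^sub>\<alpha>\<close> is short for the symmetrized tensor), and symmetrized tensors of different orbits are
  supported on disjoint sets of basis tensors. Two of them are thus proportional or orthogonal, and
  picking one nonzero tensor from each line gives an o-basis (\<open>o_basis_exists\<close>).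

  If \<open>S\<close> is a proper subset of \<open>G\<close> that contains the identity and more than half of \<open>G\<close>, there is no
  o-basis as soon as some sequence \<open>\<alpha>\<close> has trivial stabilizer (\<open>no_o_basis\<close>). The orbit of \<open>\<alpha>\<close> is then
  a copy of \<open>G\<close>, on which \<open>e\<^sub>\<alpha>\<^sub>\<tau>\<close> is supported on the translate \<open>\<tau>S\<^sup>-\<^sup>1\<close>. Two such translates
  meet, and at every common point the two coordinates contribute \<open>\<chi> \<tau>\<close> times the conjugate of
  \<open>\<chi> \<tau>'\<close>, up to a positive factor. These contributions cannot cancel, so no two symmetrized tensors
  of the orbit are orthogonal, and an o-basis contains at most one of them. But the space they
  span has dimension at least two, because \<open>\<tau>S\<^sup>-\<^sup>1\<close> differs from \<open>S\<^sup>-\<^sup>1\<close> for some \<open>\<tau>\<close>.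

  It remains to find \<open>S\<close>. For \<open>p = 2\<close> it consists of rotations \<open>a\<^sup>i\<close> of odd order and is a group; if
  \<open>p\<close> does not divide \<open>4n\<close>, it is all of \<open>G\<close>. If \<open>p\<close> is odd and divides \<open>4n\<close>, then \<open>S\<close> omits \<open>a\<close>, but
  it contains the identity and all \<open>4n\<close> elements \<open>b a\<^sup>i\<close>, whose orders divide 4; this is more than half
  of \<open>G\<close>. Three values are enough for a sequence with trivial stabilizer: mark the points 1 and 2,
  and observe that an affine map that fixes both is the identity.
\<close>

section \<open>Orthogonal systems of tensors\<close>

interpretation tensors: vector_space "tscale :: complex \<Rightarrow> 'v tensor \<Rightarrow> 'v tensor"
  by (rule tscale_vector_space)

lemma tensor_sum_apply: "(\<Sum>i\<in>I. f i) y = (\<Sum>i\<in>I. f i y)"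
  for f :: "'i \<Rightarrow> 'v tensor"
  by (induction I rule: infinite_finite_induct) auto

lemma tensor_ip_commute: "tensor_ip e k m U T = cnj (tensor_ip e k m T U)"
  by (simp add: tensor_ip_def mult.commute)

lemma tensor_ip_linear:
  "tensor_ip e k m (\<Sum>i\<in>I. tscale (c i) (f i)) U = (\<Sum>i\<in>I. c i * tensor_ip e k m (f i) U)"
  unfolding tensor_ip_def tensor_sum_apply tscale_def sum_distrib_left sum_distrib_right
  by (subst sum.swap) (simp add: mult.assoc)

text \<open>\<open>tensor_ip\<close> reads off only the coordinates at basis tensors, so it is degenerate on the type of
  all functions. Nonvanishing of \<open>u\<close> is not enough for independence, and \<open>\<langle>u, u\<rangle> \<noteq> 0\<close> takes its place.\<close>

lemma orthogonal_imp_independent: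
  assumes "\<And>u. u \<in> B \<Longrightarrow> tensor_ip e k m u u \<noteq> 0"
    and "\<And>u v. u \<in> B \<Longrightarrow> v \<in> B \<Longrightarrow> u \<noteq> v \<Longrightarrow> tensor_ip e k m u v = 0"
  shows "\<not> tensors.dependent B"
proof
  assume "tensors.dependent B"
  then obtain A c v where A: "finite A" "A \<subseteq> B" "(\<Sum>u\<in>A. tscale (c u) u) = 0"
    and v: "v \<in> A" "c v \<noteq> 0"
    unfolding tensors.dependent_explicit by blast
  have "0 = tensor_ip e k m (\<Sum>u\<in>A. tscale (c u) u) v"
    unfolding A(3) by (simp add: tensor_ip_def)
  also have "\<dots> = (\<Sum>u\<in>A. if u = v then c v * tensor_ip e k m v v else 0)"
    unfolding tensor_ip_linear using A(2) v(1) assms(2) by (intro sum.cong) auto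
  also have "\<dots> = c v * tensor_ip e k m v v"
    using A(1) v(1) by simp
  finally show False using v A(2) assms(1)[of v] by auto
qed

text \<open>A greedy choice works: a new tensor outside the span of those chosen so far is not a multiple of
  any of them, hence orthogonal to all of them.\<close>

lemma orthogonal_subset_spanning:
  assumes "finite E"
    and "\<And>u v. u \<in> E \<Longrightarrow> v \<in> E \<Longrightarrow> tensor_ip e k m u v = 0 \<or> (\<exists>c. v = tscale c u)"
  shows "\<exists>B\<subseteq>E. 0 \<notin> B \<and> tensors.span B = tensors.span E \<and>
           (\<forall>u\<in>B. \<forall>v\<in>B. u \<noteq> v \<longrightarrow> tensor_ip e k m u v = 0)"
  using assms
proof (induction E)
  case empty
  show ?case by simp
next
  case (insert x E)
  have "\<exists>B\<subseteq>E. 0 \<notin> B \<and> tensors.span B = tensors.span E \<and>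
      (\<forall>u\<in>B. \<forall>v\<in>B. u \<noteq> v \<longrightarrow> tensor_ip e k m u v = 0)"
    by (rule insert.IH) (rule insert.prems, simp_all)
  then obtain B where B: "B \<subseteq> E" "0 \<notin> B" "tensors.span B = tensors.span E"
      "\<forall>u\<in>B. \<forall>v\<in>B. u \<noteq> v \<longrightarrow> tensor_ip e k m u v = 0"
    by blast
  show ?case
  proof (cases "x \<in> tensors.span B")
    case True
    then have "tensors.span B = tensors.span (insert x E)"
      unfolding B(3) by (simp add: tensors.span_redundant)
    with B show ?thesis by blast
  next
    case False
    have "tensor_ip e k m u x = 0" if "u \<in> B" for u
    proof -
      have "\<nexists>c. x = tscale c u"
        using False that tensors.span_base tensors.span_scale by metis
      then show ?thesis using insert.prems[of u x] that B(1) by auto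
    qed
    moreover from this have "tensor_ip e k m x u = 0" if "u \<in> B" for u
      using that tensor_ip_commute[of e k m x u] by simp
    moreover have "x \<noteq> 0" using False tensors.span_zero by auto
    moreover have "tensors.span (insert x B) = tensors.span (insert x E)"
      unfolding tensors.span_insert B(3) ..
    ultimately show ?thesis
      using B(1,2,4) by (intro exI[of _ "insert x B"]) (intro conjI; blast)
  qed
qed

section \<open>Symmetrized tensors of a permutation group with a linear character\<close>

locale permutation_character = complex_inner_space scale ip
  for scale :: "complex \<Rightarrow> 'v::ab_group_add \<Rightarrow> 'v" and ip +
  fixes k m :: nat and e :: "nat \<Rightarrow> 'v"
    and G :: "(nat \<Rightarrow> nat) set" and \<chi> :: "(nat \<Rightarrow> nat) \<Rightarrow> complex"
  assumes onb: "orthonormal_basis scale ip k e"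
    and G: "subgroup G (sym_group m)"
    and char_mult: "\<sigma> \<in> G \<Longrightarrow> \<tau> \<in> G \<Longrightarrow> \<chi> (\<sigma> \<circ> \<tau>) = \<chi> \<sigma> * \<chi> \<tau>"
    and char_nonzero: "\<sigma> \<in> G \<Longrightarrow> \<chi> \<sigma> \<noteq> 0"
begin

lemma permutes: "\<sigma> \<in> G \<Longrightarrow> \<sigma> permutes {1..m}"
  using subgroup.subset[OF G] by (auto simp: sym_group_carrier)

lemma id_in: "id \<in> G"
  using subgroup.one_closed[OF G] by (simp add: sym_group_one)

lemma comp_in: "\<sigma> \<in> G \<Longrightarrow> \<tau> \<in> G \<Longrightarrow> \<sigma> \<circ> \<tau> \<in> G"
  using subgroup.m_closed[OF G] by (simp add: sym_group_mult)

lemma inv_in: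
  assumes "\<sigma> \<in> G" shows "inv' \<sigma> \<in> G"
  using subgroup.m_inv_closed[OF G assms] subgroup.subset[OF G] assms
  by (metis subsetD sym_group_inv_equality)

lemma inv_comp:
  assumes "\<sigma> \<in> G" shows "inv' \<sigma> \<circ> \<sigma> = id" "\<sigma> \<circ> inv' \<sigma> = id"
  using permutes_inv_o[OF permutes[OF assms]] by auto

lemma inv_inv: "\<sigma> \<in> G \<Longrightarrow> inv' (inv' \<sigma>) = \<sigma>"
  using permutes_inv_inv[OF permutes] .

text \<open>The coordinate of the symmetrization of \<open>\<alpha> \<circ> \<tau>\<close> at \<open>\<alpha> \<circ> \<rho>\<close> involves the \<open>\<sigma>\<close> with
  \<open>\<tau> \<sigma>\<^sup>-\<^sup>1 = \<rho>\<close>, which this solves for \<open>\<sigma>\<close>.\<close>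

lemma comp_inv_eq_iff:
  assumes "\<tau> \<in> G" "\<sigma> \<in> G" "\<rho> \<in> G"
  shows "\<tau> \<circ> inv' \<sigma> = \<rho> \<longleftrightarrow> \<sigma> = inv' \<rho> \<circ> \<tau>"
proof
  assume "\<tau> \<circ> inv' \<sigma> = \<rho>"
  then have "inv' \<rho> \<circ> \<tau> = inv' \<rho> \<circ> \<rho> \<circ> \<sigma>"
    using inv_comp[OF assms(2)] by (metis comp_assoc comp_id)
  then show "\<sigma> = inv' \<rho> \<circ> \<tau>" using inv_comp[OF assms(3)] by simp
next
  assume "\<sigma> = inv' \<rho> \<circ> \<tau>"
  then have "\<rho> \<circ> \<sigma> = \<tau>"
    using inv_comp[OF assms(3)] by (metis comp_assoc id_comp)
  then show "\<tau> \<circ> inv' \<sigma> = \<rho>"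
    using inv_comp[OF assms(2)] by (metis comp_assoc comp_id)
qed

lemma finite_G: "finite G"
  by (rule finite_subset[OF _ finite_permutations[of "{1..m}"]]) (use permutes in auto)

lemma char_id: "\<chi> id = 1"
  using char_mult[OF id_in id_in] char_nonzero[OF id_in] by simp

lemma finite_seqs: "finite (seqs m k)"
  unfolding seqs_def by (rule finite_PiE) auto

lemma seqs_comp:
  assumes "\<alpha> \<in> seqs m k" "\<sigma> \<in> G"
  shows "\<alpha> \<circ> \<sigma> \<in> seqs m k"
  using assms(1) permutes_in_image[OF permutes[OF assms(2)]] permutes_not_in[OF permutes[OF assms(2)]]
  unfolding seqs_def PiE_iff extensional_def by auto

lemma basis_tensor_coordinate:
  assumes "\<alpha> \<in> seqs m k" "\<beta> \<in> seqs m k"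
  shows "basis_tensor ip e m \<alpha> (e \<circ> \<beta>) = (if \<alpha> = \<beta> then 1 else 0)"
proof -
  let ?u = "basis_tensor ip e m \<alpha>" and ?v = "basis_tensor ip e m \<beta>"
  have on: "ip (e i) (e j) = (if i = j then 1 else 0)" if "i \<in> {1..k}" "j \<in> {1..k}" for i j
    using onb that unfolding orthonormal_basis_def by blast
  have "?u (e \<circ> \<beta>) = (\<Prod>i\<in>{1..m}. ip (e (\<alpha> i)) (e (\<beta> i)))"
    by (simp add: basis_tensor_def pure_tensor_def)
  also have "\<dots> = tensor_ip e k m ?u ?v"
    using tensor_ip_pure[OF onb, of m "e \<circ> \<alpha>" "e \<circ> \<beta>"] by (simp add: basis_tensor_def)
  also have "\<dots> = (if \<alpha> = \<beta> then 1 else 0)"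
    by (rule basis_tensor_orthonormal[OF onb assms])
  finally show ?thesis .
qed

lemma sym_tensor_coordinate:
  assumes "S \<subseteq> G" "\<alpha> \<in> seqs m k" "\<beta> \<in> seqs m k"
  shows "sym_tensor ip e m S \<phi> \<alpha> (e \<circ> \<beta>) =
    \<phi> id / of_nat (card S) * (\<Sum>\<sigma>\<in>S. if \<alpha> \<circ> inv' \<sigma> = \<beta> then \<phi> \<sigma> else 0)"
proof -
  have "(\<Sum>\<sigma>\<in>S. \<phi> \<sigma> * basis_tensor ip e m (\<alpha> \<circ> inv' \<sigma>) (e \<circ> \<beta>)) =
      (\<Sum>\<sigma>\<in>S. if \<alpha> \<circ> inv' \<sigma> = \<beta> then \<phi> \<sigma> else 0)"
    using assms seqs_comp inv_in
    by (intro sum.cong refl) (subst basis_tensor_coordinate, auto)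
  then show ?thesis
    by (simp add: sym_tensor_def tscale_def tensor_sum_apply)
qed

lemma sym_tensor_coordinate_nonzero:
  assumes "S \<subseteq> G" "\<alpha> \<in> seqs m k" "\<beta> \<in> seqs m k" "sym_tensor ip e m S \<phi> \<alpha> (e \<circ> \<beta>) \<noteq> 0"
  shows "\<exists>\<sigma>\<in>S. \<alpha> \<circ> inv' \<sigma> = \<beta>"
proof (rule ccontr)
  assume "\<not> ?thesis"
  then have "(\<Sum>\<sigma>\<in>S. if \<alpha> \<circ> inv' \<sigma> = \<beta> then \<phi> \<sigma> else 0) = 0"
    by (intro sum.neutral) auto
  then show False
    using assms(4) unfolding sym_tensor_coordinate[OF assms(1-3)] by simp
qed

text \<open>Symmetrized tensors are determined by their coordinates, which makes \<open>tensor_ip\<close> definite on them.\<close>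

lemma sym_tensor_expansion:
  assumes "S \<subseteq> G" "\<alpha> \<in> seqs m k"
  shows "sym_tensor ip e m S \<phi> \<alpha> =
    (\<Sum>\<beta>\<in>seqs m k. tscale (sym_tensor ip e m S \<phi> \<alpha> (e \<circ> \<beta>)) (basis_tensor ip e m \<beta>))"
proof -
  let ?bt = "basis_tensor ip e m" and ?c = "\<phi> id / of_nat (card S)"
  have "(\<Sum>\<beta>\<in>seqs m k. tscale (sym_tensor ip e m S \<phi> \<alpha> (e \<circ> \<beta>)) (?bt \<beta>)) y =
      sym_tensor ip e m S \<phi> \<alpha> y" for y
  proof -
    have "(\<Sum>\<beta>\<in>seqs m k. sym_tensor ip e m S \<phi> \<alpha> (e \<circ> \<beta>) * ?bt \<beta> y) =
        (\<Sum>\<beta>\<in>seqs m k. \<Sum>\<sigma>\<in>S. if \<alpha> \<circ> inv' \<sigma> = \<beta> then ?c * \<phi> \<sigma> * ?bt \<beta> y else 0)"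
      using assms by (intro sum.cong refl)
        (simp add: sym_tensor_coordinate sum_distrib_left sum_distrib_right if_distrib if_distribR cong: if_cong)
    also have "\<dots> = (\<Sum>\<sigma>\<in>S. \<Sum>\<beta>\<in>seqs m k. if \<alpha> \<circ> inv' \<sigma> = \<beta> then ?c * \<phi> \<sigma> * ?bt \<beta> y else 0)"
      by (rule sum.swap)
    also have "\<dots> = (\<Sum>\<sigma>\<in>S. ?c * \<phi> \<sigma> * ?bt (\<alpha> \<circ> inv' \<sigma>) y)"
      using assms seqs_comp inv_in finite_seqs by (intro sum.cong refl) auto
    finally show ?thesis
      by (simp add: sym_tensor_def tscale_def tensor_sum_apply sum_distrib_left mult.assoc)
  qed
  then show ?thesis by (intro ext) (simp add: tensor_sum_apply)
qed

lemma sym_tensor_ip_self: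
  assumes "S \<subseteq> G" "\<alpha> \<in> seqs m k" "sym_tensor ip e m S \<phi> \<alpha> \<noteq> 0"
  shows "tensor_ip e k m (sym_tensor ip e m S \<phi> \<alpha>) (sym_tensor ip e m S \<phi> \<alpha>) \<noteq> 0"
proof
  let ?u = "sym_tensor ip e m S \<phi> \<alpha>"
  assume "tensor_ip e k m ?u ?u = 0"
  then have "(\<Sum>\<beta>\<in>seqs m k. (cmod (?u (e \<circ> \<beta>)))\<^sup>2) = 0"
    unfolding tensor_ip_def complex_norm_square[symmetric] of_real_sum[symmetric]
    by (simp only: of_real_eq_0_iff)
  then have "?u (e \<circ> \<beta>) = 0" if "\<beta> \<in> seqs m k" for \<beta>
    using that finite_seqs by (simp add: sum_nonneg_eq_0_iff)
  then have "?u = 0"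
    by (subst sym_tensor_expansion[OF assms(1,2)]) simp
  with assms(3) show False ..
qed

subsection \<open>Symmetrizing over the whole group\<close>

text \<open>Substituting \<open>\<sigma> \<tau>\<close> for \<open>\<sigma>\<close> in the defining sum pulls out the factor \<open>\<chi> \<tau>\<close>.\<close>

lemma sym_tensor_translate:
  assumes "\<tau> \<in> G"
  shows "sym_tensor ip e m G \<chi> \<alpha> = tscale (\<chi> \<tau>) (sym_tensor ip e m G \<chi> (\<alpha> \<circ> inv' \<tau>))"
proof -
  have bij: "bij_betw (\<lambda>\<sigma>. \<sigma> \<circ> \<tau>) G G"
  proof (rule bij_betw_byWitness[where f' = "\<lambda>\<sigma>. \<sigma> \<circ> inv' \<tau>"])
    show "\<forall>\<sigma>\<in>G. \<sigma> \<circ> \<tau> \<circ> inv' \<tau> = \<sigma>" "\<forall>\<sigma>\<in>G. \<sigma> \<circ> inv' \<tau> \<circ> \<tau> = \<sigma>"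
      using inv_comp[OF assms] by (simp_all add: comp_assoc)
  qed (use assms inv_in comp_in in auto)
  have inv_prod: "inv' (\<sigma> \<circ> \<tau>) = inv' \<tau> \<circ> inv' \<sigma>" if "\<sigma> \<in> G" for \<sigma>
    using that assms permutes by (meson o_inv_distrib permutes_bij)
  have "(\<Sum>\<sigma>\<in>G. tscale (\<chi> \<sigma>) (basis_tensor ip e m (\<alpha> \<circ> inv' \<sigma>))) =
      (\<Sum>\<sigma>\<in>G. tscale (\<chi> (\<sigma> \<circ> \<tau>)) (basis_tensor ip e m (\<alpha> \<circ> inv' (\<sigma> \<circ> \<tau>))))"
    by (rule sum.reindex_bij_betw[OF bij, symmetric])
  also have "\<dots> = (\<Sum>\<sigma>\<in>G. tscale (\<chi> \<tau>) (tscale (\<chi> \<sigma>) (basis_tensor ip e m (\<alpha> \<circ> inv' \<tau> \<circ> inv' \<sigma>))))"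
    using assms by (intro sum.cong refl) (simp add: char_mult inv_prod comp_assoc mult.commute)
  finally show ?thesis
    unfolding sym_tensor_def tensors.scale_sum_right[symmetric]
    by (simp add: mult.commute)
qed

text \<open>If the supports meet, then \<open>\<alpha>\<close> and \<open>\<beta>\<close> lie in the same orbit, and the tensors are proportional;
  otherwise every term of the inner product vanishes.\<close>

lemma sym_tensor_orthogonal_or_proportional:
  assumes "\<alpha> \<in> seqs m k" "\<beta> \<in> seqs m k"
  shows "tensor_ip e k m (sym_tensor ip e m G \<chi> \<alpha>) (sym_tensor ip e m G \<chi> \<beta>) = 0 \<or>
    (\<exists>c. sym_tensor ip e m G \<chi> \<beta> = tscale c (sym_tensor ip e m G \<chi> \<alpha>))"
proof (rule disjCI)
  assume "\<nexists>c. sym_tensor ip e m G \<chi> \<beta> = tscale c (sym_tensor ip e m G \<chi> \<alpha>)"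
  then have orbit: "\<beta> \<circ> inv' \<rho> \<noteq> \<alpha>" if "\<rho> \<in> G" for \<rho>
    using sym_tensor_translate[OF that] by metis
  show "tensor_ip e k m (sym_tensor ip e m G \<chi> \<alpha>) (sym_tensor ip e m G \<chi> \<beta>) = 0"
    unfolding tensor_ip_def
  proof (rule sum.neutral, rule ballI, rule ccontr)
    fix \<gamma> assume \<gamma>: "\<gamma> \<in> seqs m k"
      and "sym_tensor ip e m G \<chi> \<alpha> (e \<circ> \<gamma>) * cnj (sym_tensor ip e m G \<chi> \<beta> (e \<circ> \<gamma>)) \<noteq> 0"
    then have "sym_tensor ip e m G \<chi> \<alpha> (e \<circ> \<gamma>) \<noteq> 0" "sym_tensor ip e m G \<chi> \<beta> (e \<circ> \<gamma>) \<noteq> 0"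
      by auto
    then obtain \<sigma> \<tau> where *: "\<sigma> \<in> G" "\<tau> \<in> G" "\<alpha> \<circ> inv' \<sigma> = \<gamma>" "\<beta> \<circ> inv' \<tau> = \<gamma>"
      using sym_tensor_coordinate_nonzero[OF order_refl assms(1) \<gamma>]
        sym_tensor_coordinate_nonzero[OF order_refl assms(2) \<gamma>] by blast
    have "\<beta> \<circ> inv' \<tau> \<circ> \<sigma> = \<alpha> \<circ> (inv' \<sigma> \<circ> \<sigma>)"
      unfolding *(4) *(3)[symmetric] by (simp add: comp_assoc)
    then have "\<beta> \<circ> (inv' \<tau> \<circ> \<sigma>) = \<alpha>"
      unfolding inv_comp(1)[OF *(1)] by (simp only: comp_assoc comp_id)
    moreover have "inv' \<tau> \<circ> \<sigma> \<in> G" using comp_in inv_in *(1,2) by blast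
    ultimately show False using orbit[of "inv' (inv' \<tau> \<circ> \<sigma>)"] inv_in inv_inv by simp
  qed
qed

theorem o_basis_exists:
  "\<exists>B. o_basis ip k e m G \<chi> (symmetry_class ip k e m G \<chi>) B"
proof -
  let ?E = "sym_tensor ip e m G \<chi> ` seqs m k"
  have "\<exists>B\<subseteq>?E. 0 \<notin> B \<and> tensors.span B = tensors.span ?E \<and>
      (\<forall>u\<in>B. \<forall>v\<in>B. u \<noteq> v \<longrightarrow> tensor_ip e k m u v = 0)"
  proof (rule orthogonal_subset_spanning)
    show "finite ?E" using finite_seqs by simp
    fix u v assume "u \<in> ?E" "v \<in> ?E"
    then obtain \<alpha> \<beta> where "\<alpha> \<in> seqs m k" "\<beta> \<in> seqs m k"
        and uv: "u = sym_tensor ip e m G \<chi> \<alpha>" "v = sym_tensor ip e m G \<chi> \<beta>"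
      by blast
    then show "tensor_ip e k m u v = 0 \<or> (\<exists>c. v = tscale c u)"
      unfolding uv by (intro sym_tensor_orthogonal_or_proportional)
  qed
  then obtain B where B: "B \<subseteq> ?E" "0 \<notin> B" "tensors.span B = tensors.span ?E"
      "\<forall>u\<in>B. \<forall>v\<in>B. u \<noteq> v \<longrightarrow> tensor_ip e k m u v = 0"
    by blast
  moreover have "\<not> tensors.dependent B"
  proof (rule orthogonal_imp_independent)
    fix u assume u: "u \<in> B"
    show "tensor_ip e k m u u \<noteq> 0"
    proof -
      obtain \<alpha> where "\<alpha> \<in> seqs m k" "u = sym_tensor ip e m G \<chi> \<alpha>"
        using u B(1) by blast
      moreover have "u \<noteq> 0" using u B(2) by blast
      ultimately show ?thesis using sym_tensor_ip_self[OF order_refl] by metis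
    qed
  qed (use B(4) in auto)
  ultimately show ?thesis
    unfolding o_basis_def symmetry_class_def by blast
qed

subsection \<open>Symmetrizing over more than half of the group\<close>

lemma trivial_stabilizer_imp_inj:
  assumes "\<And>\<sigma>. \<sigma> \<in> G \<Longrightarrow> \<alpha> \<circ> \<sigma> = \<alpha> \<Longrightarrow> \<sigma> = id"
  shows "inj_on ((\<circ>) \<alpha>) G"
proof (rule inj_onI)
  fix \<sigma> \<rho> assume *: "\<sigma> \<in> G" "\<rho> \<in> G" "\<alpha> \<circ> \<sigma> = \<alpha> \<circ> \<rho>"
  have "\<alpha> \<circ> (\<sigma> \<circ> inv' \<rho>) = \<alpha> \<circ> \<rho> \<circ> inv' \<rho>"
    unfolding comp_assoc[symmetric] *(3) ..
  also have "\<dots> = \<alpha>"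
    by (simp only: comp_assoc inv_comp(2)[OF *(2)] comp_id)
  finally have "\<sigma> \<circ> inv' \<rho> = id"
    using assms comp_in inv_in *(1,2) by blast
  then show "\<sigma> = \<rho>"
    using comp_inv_eq_iff[OF *(1,2) id_in] by simp
qed

text \<open>On a free orbit, only \<open>\<sigma> = \<rho>\<^sup>-\<^sup>1 \<tau>\<close> contributes. The symmetrized tensor of \<open>\<alpha> \<circ> \<tau>\<close> is thus
  supported on the translate \<open>\<tau> S\<^sup>-\<^sup>1\<close>, with a value that is a product of a factor depending on \<open>\<tau>\<close>
  and one depending on \<open>\<rho>\<close>.\<close>

lemma sym_tensor_free_orbit:
  assumes "S \<subseteq> G" "id \<in> S" "\<alpha> \<in> seqs m k" "inj_on ((\<circ>) \<alpha>) G" "\<tau> \<in> G" "\<rho> \<in> G"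
    and "\<And>\<sigma>. \<sigma> \<in> S \<Longrightarrow> \<phi> \<sigma> = \<chi> \<sigma>"
  shows "sym_tensor ip e m S \<phi> (\<alpha> \<circ> \<tau>) (e \<circ> (\<alpha> \<circ> \<rho>)) =
    (if inv' \<rho> \<circ> \<tau> \<in> S then \<chi> (inv' \<rho>) * \<chi> \<tau> / of_nat (card S) else 0)"
proof -
  have fin: "finite S" using assms(1) finite_G finite_subset by blast
  have "(\<alpha> \<circ> \<tau>) \<circ> inv' \<sigma> = \<alpha> \<circ> \<rho> \<longleftrightarrow> \<sigma> = inv' \<rho> \<circ> \<tau>" if "\<sigma> \<in> S" for \<sigma>
  proof -
    have \<sigma>: "\<sigma> \<in> G" using that assms(1) by auto
    have "(\<alpha> \<circ> \<tau>) \<circ> inv' \<sigma> = \<alpha> \<circ> \<rho> \<longleftrightarrow> \<tau> \<circ> inv' \<sigma> = \<rho>"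
      using inj_onD[OF assms(4), of "\<tau> \<circ> inv' \<sigma>" \<rho>] comp_in inv_in assms(5,6) \<sigma>
      by (auto simp: comp_assoc)
    then show ?thesis using comp_inv_eq_iff[OF assms(5) \<sigma> assms(6)] by simp
  qed
  then have "(\<Sum>\<sigma>\<in>S. if (\<alpha> \<circ> \<tau>) \<circ> inv' \<sigma> = \<alpha> \<circ> \<rho> then \<phi> \<sigma> else 0) =
      (\<Sum>\<sigma>\<in>S. if \<sigma> = inv' \<rho> \<circ> \<tau> then \<chi> (inv' \<rho> \<circ> \<tau>) else 0)"
    using assms(7) by (intro sum.cong refl) auto
  also have "\<dots> = (if inv' \<rho> \<circ> \<tau> \<in> S then \<chi> (inv' \<rho>) * \<chi> \<tau> else 0)"
    using fin char_mult[OF inv_in] assms(5,6) by simp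
  finally show ?thesis
    using assms(2,7) char_id seqs_comp[OF assms(3)] assms(5,6)
    by (simp add: sym_tensor_coordinate[OF assms(1)])
qed

text \<open>The sets \<open>\<tau> S\<^sup>-\<^sup>1\<close> and \<open>\<tau>' S\<^sup>-\<^sup>1\<close> each contain more than half of \<open>G\<close>, so they have a common
  element \<open>\<rho>\<close>.\<close>

lemma large_subset_translates_meet:
  assumes "S \<subseteq> G" "card G < 2 * card S" "\<tau> \<in> G" "\<tau>' \<in> G"
  shows "\<exists>\<rho>\<in>G. inv' \<rho> \<circ> \<tau> \<in> S \<and> inv' \<rho> \<circ> \<tau>' \<in> S"
proof -
  define R where "R \<tau> = (\<lambda>\<sigma>. \<tau> \<circ> inv' \<sigma>) ` S" for \<tau> :: "nat \<Rightarrow> nat"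
  have R: "R \<tau> \<subseteq> G" "card (R \<tau>) = card S" "\<And>\<rho>. \<rho> \<in> R \<tau> \<Longrightarrow> inv' \<rho> \<circ> \<tau> \<in> S" if "\<tau> \<in> G" for \<tau>
  proof -
    show "R \<tau> \<subseteq> G" using that assms(1) comp_in inv_in by (auto simp: R_def)
    have eq: "inv' (\<tau> \<circ> inv' \<sigma>) \<circ> \<tau> = \<sigma>" if \<sigma>: "\<sigma> \<in> S" for \<sigma>
    proof -
      have "\<sigma> \<in> G" using \<sigma> assms(1) by blast
      moreover from this have "\<tau> \<circ> inv' \<sigma> \<in> G" using comp_in inv_in \<open>\<tau> \<in> G\<close> by blast
      ultimately show ?thesis
        using comp_inv_eq_iff[OF \<open>\<tau> \<in> G\<close>, of \<sigma> "\<tau> \<circ> inv' \<sigma>"] by (simp only: simp_thms)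
    qed
    then have "inj_on (\<lambda>\<sigma>. \<tau> \<circ> inv' \<sigma>) S"
      by (rule inj_on_inverseI[where g = "\<lambda>\<rho>. inv' \<rho> \<circ> \<tau>"])
    then show "card (R \<tau>) = card S" unfolding R_def by (rule card_image)
    fix \<rho> assume "\<rho> \<in> R \<tau>"
    then obtain \<sigma> where "\<sigma> \<in> S" "\<rho> = \<tau> \<circ> inv' \<sigma>" unfolding R_def by blast
    with eq[of \<sigma>] show "inv' \<rho> \<circ> \<tau> \<in> S" by (simp only:)
  qed
  have fin: "finite (R \<tau>)" "finite (R \<tau>')"
    using R(1) assms(3,4) finite_G finite_subset by blast+
  have "R \<tau> \<inter> R \<tau>' \<noteq> {}"
  proof
    assume "R \<tau> \<inter> R \<tau>' = {}"
    then have "card (R \<tau> \<union> R \<tau>') = 2 * card S"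
      using card_Un_disjoint[OF fin] R(2) assms(3,4) by simp
    moreover have "card (R \<tau> \<union> R \<tau>') \<le> card G"
      using R(1) assms(3,4) by (intro card_mono finite_G) auto
    ultimately show False using assms(2) by simp
  qed
  then show ?thesis using R assms(3,4) by blast
qed

text \<open>Each common point \<open>\<rho>\<close> of the two supports contributes \<open>\<chi> \<tau>\<close> times the conjugate of \<open>\<chi> \<tau>'\<close>,
  multiplied by the positive number \<open>\<bar>\<chi> (\<rho>\<^sup>-\<^sup>1)\<bar>\<^sup>2 / \<bar>S\<bar>\<^sup>2\<close>. The common phase rules out cancellation.\<close>

lemma sym_tensor_free_orbit_not_orthogonal:
  assumes "S \<subseteq> G" "id \<in> S" "card G < 2 * card S" "\<alpha> \<in> seqs m k" "inj_on ((\<circ>) \<alpha>) G"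
    and "\<tau> \<in> G" "\<tau>' \<in> G" and \<phi>: "\<And>\<sigma>. \<sigma> \<in> S \<Longrightarrow> \<phi> \<sigma> = \<chi> \<sigma>"
  shows "tensor_ip e k m (sym_tensor ip e m S \<phi> (\<alpha> \<circ> \<tau>)) (sym_tensor ip e m S \<phi> (\<alpha> \<circ> \<tau>')) \<noteq> 0"
proof -
  let ?u = "sym_tensor ip e m S \<phi> (\<alpha> \<circ> \<tau>)" and ?v = "sym_tensor ip e m S \<phi> (\<alpha> \<circ> \<tau>')"
  let ?N = "of_nat (card S) :: complex"
  note free = sym_tensor_free_orbit[OF assms(1,2,4,5) _ _ \<phi>]
  define R where "R = {\<rho>\<in>G. inv' \<rho> \<circ> \<tau> \<in> S \<and> inv' \<rho> \<circ> \<tau>' \<in> S}"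
  have "R \<noteq> {}" using large_subset_translates_meet[OF assms(1,3,6,7)] by (auto simp: R_def)
  moreover have "finite R" using finite_G by (simp add: R_def)
  ultimately have pos: "0 < (\<Sum>\<rho>\<in>R. (cmod (\<chi> (inv' \<rho>)))\<^sup>2)"
    using char_nonzero inv_in by (intro sum_pos) (auto simp: R_def)
  have outside: "?u (e \<circ> \<beta>) = 0" if \<beta>: "\<beta> \<in> seqs m k" "\<beta> \<notin> (\<circ>) \<alpha> ` G" for \<beta>
  proof (rule ccontr)
    assume "?u (e \<circ> \<beta>) \<noteq> 0"
    then obtain \<sigma> where "\<sigma> \<in> S" "\<alpha> \<circ> \<tau> \<circ> inv' \<sigma> = \<beta>"
      using sym_tensor_coordinate_nonzero[OF assms(1) seqs_comp[OF assms(4,6)] \<beta>(1)] by blast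
    then have "\<beta> = \<alpha> \<circ> (\<tau> \<circ> inv' \<sigma>)" "\<tau> \<circ> inv' \<sigma> \<in> G"
      using assms(1,6) comp_in inv_in by (auto simp: comp_assoc)
    with \<beta>(2) show False by blast
  qed
  have "tensor_ip e k m ?u ?v = (\<Sum>\<beta>\<in>(\<circ>) \<alpha> ` G. ?u (e \<circ> \<beta>) * cnj (?v (e \<circ> \<beta>)))"
    unfolding tensor_ip_def using outside seqs_comp[OF assms(4)]
    by (intro sum.mono_neutral_right finite_seqs) auto
  also have "\<dots> = (\<Sum>\<rho>\<in>G. ?u (e \<circ> (\<alpha> \<circ> \<rho>)) * cnj (?v (e \<circ> (\<alpha> \<circ> \<rho>))))"
    using sum.reindex[OF assms(5)] by simp
  also have "\<dots> = (\<Sum>\<rho>\<in>R. ?u (e \<circ> (\<alpha> \<circ> \<rho>)) * cnj (?v (e \<circ> (\<alpha> \<circ> \<rho>))))"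
    using free assms(6,7) by (intro sum.mono_neutral_right finite_G) (auto simp: R_def)
  also have "\<dots> = (\<Sum>\<rho>\<in>R. (\<chi> \<tau> * cnj (\<chi> \<tau>') / (?N * ?N)) * of_real ((cmod (\<chi> (inv' \<rho>)))\<^sup>2))"
    using free assms(6,7) by (intro sum.cong refl)
      (simp add: R_def complex_norm_square mult.commute mult.left_commute del: of_real_power)
  also have "\<dots> = (\<chi> \<tau> * cnj (\<chi> \<tau>') / (?N * ?N)) * of_real (\<Sum>\<rho>\<in>R. (cmod (\<chi> (inv' \<rho>)))\<^sup>2)"
    by (simp only: sum_distrib_left of_real_sum)
  finally have "tensor_ip e k m ?u ?v = \<dots>" .
  moreover have "card S \<noteq> 0" using assms(3) by simp
  ultimately show ?thesis
    using pos char_nonzero[OF assms(6)] char_nonzero[OF assms(7)]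
    by (simp del: of_real_sum of_real_power)
qed

text \<open>An o-basis contains at most one element \<open>w\<close> from the orbit of \<open>\<alpha>\<close>, and its other elements vanish on
  that orbit. Restricted to the orbit, every tensor of the symmetry class is then a multiple of \<open>w\<close>,
  so all symmetrized tensors of the orbit have the same support there. This fails for \<open>\<alpha>\<close> and
  \<open>\<alpha> \<circ> g\<close> with \<open>g \<notin> S\<close>: the point \<open>\<alpha>\<close> lies in the support of the first only.\<close>

theorem no_o_basis:
  assumes "S \<subset> G" "id \<in> S" "card G < 2 * card S" "\<alpha> \<in> seqs m k"
    and stabilizer: "\<And>\<sigma>. \<sigma> \<in> G \<Longrightarrow> \<alpha> \<circ> \<sigma> = \<alpha> \<Longrightarrow> \<sigma> = id"
    and \<phi>: "\<And>\<sigma>. \<sigma> \<in> S \<Longrightarrow> \<phi> \<sigma> = \<chi> \<sigma>"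
  shows "\<not> o_basis ip k e m S \<phi> (symmetry_class ip k e m S \<phi>) B"
proof
  let ?t = "sym_tensor ip e m S \<phi>"
  assume B: "o_basis ip k e m S \<phi> (symmetry_class ip k e m S \<phi>) B"
  have S: "S \<subseteq> G" using assms(1) by auto
  have inj: "inj_on ((\<circ>) \<alpha>) G" using trivial_stabilizer_imp_inj stabilizer by blast
  note free = sym_tensor_free_orbit[OF S assms(2,4) inj _ _ \<phi>]
  have single: "u = v" if "u \<in> B" "v \<in> B" "u = ?t (\<alpha> \<circ> \<tau>)" "v = ?t (\<alpha> \<circ> \<tau>')" "\<tau> \<in> G" "\<tau>' \<in> G" for u v \<tau> \<tau>'
    using sym_tensor_free_orbit_not_orthogonal[OF S assms(2-4) inj that(5,6) \<phi>] that(1-4) B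
    unfolding o_basis_def by blast
  \<comment> \<open>If the basis contains no tensor of the orbit, any value of \<open>w\<close> will do.\<close>
  obtain w :: "'v tensor" where w: "\<And>u \<tau>. u \<in> B \<Longrightarrow> \<tau> \<in> G \<Longrightarrow> u = ?t (\<alpha> \<circ> \<tau>) \<Longrightarrow> u = w"
    using single by metis
  have "\<exists>c. \<forall>\<rho>\<in>G. T (e \<circ> (\<alpha> \<circ> \<rho>)) = c * w (e \<circ> (\<alpha> \<circ> \<rho>))" if "T \<in> tensors.span B" for T
    using that
  proof (induction rule: tensors.span_induct_alt)
    case base
    show ?case by (intro exI[of _ 0]) simp
  next
    case (step a u T)
    then obtain c where c: "\<forall>\<rho>\<in>G. T (e \<circ> (\<alpha> \<circ> \<rho>)) = c * w (e \<circ> (\<alpha> \<circ> \<rho>))" by blast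
    show ?case
    proof (cases "\<exists>\<tau>\<in>G. u = ?t (\<alpha> \<circ> \<tau>)")
      case True
      with w step(1) have "u = w" by blast
      with c show ?thesis
        by (intro exI[of _ "a + c"] ballI) (simp only: plus_fun_apply tscale_def distrib_right)
    next
      case False
      obtain \<beta> where \<beta>: "\<beta> \<in> seqs m k" "u = ?t \<beta>"
        using step(1) B unfolding o_basis_def by blast
      have "u (e \<circ> (\<alpha> \<circ> \<rho>)) = 0" if \<rho>: "\<rho> \<in> G" for \<rho>
      proof (rule ccontr)
        assume "u (e \<circ> (\<alpha> \<circ> \<rho>)) \<noteq> 0"
        then obtain \<sigma> where \<sigma>: "\<sigma> \<in> S" "\<beta> \<circ> inv' \<sigma> = \<alpha> \<circ> \<rho>"
          using sym_tensor_coordinate_nonzero[OF S \<beta>(1) seqs_comp[OF assms(4) \<rho>]] \<beta>(2) by blast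
        then have "\<beta> = \<alpha> \<circ> (\<rho> \<circ> \<sigma>)"
          using inv_comp[of \<sigma>] S by (metis comp_assoc comp_id subsetD)
        then show False using False \<beta>(2) \<rho> \<sigma>(1) S comp_in by blast
      qed
      with c show ?thesis
        by (intro exI[of _ c] ballI) (simp only: plus_fun_apply tscale_def mult_zero_right add_0_left)
    qed
  qed
  moreover have "?t (\<alpha> \<circ> \<tau>) \<in> tensors.span B" if "\<tau> \<in> G" for \<tau>
  proof -
    have "?t (\<alpha> \<circ> \<tau>) \<in> tensors.span (?t ` seqs m k)"
      by (intro tensors.span_base imageI seqs_comp[OF assms(4) that])
    also have "\<dots> = tensors.span B"
      using B by (simp only: o_basis_def symmetry_class_def)
    finally show ?thesis .
  qed
  ultimately have line: "\<exists>c. \<forall>\<rho>\<in>G. ?t (\<alpha> \<circ> \<tau>) (e \<circ> (\<alpha> \<circ> \<rho>)) = c * w (e \<circ> (\<alpha> \<circ> \<rho>))"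
    if "\<tau> \<in> G" for \<tau>
    using that by blast
  have supp: "?t (\<alpha> \<circ> \<tau>) (e \<circ> (\<alpha> \<circ> \<rho>)) \<noteq> 0 \<longleftrightarrow> inv' \<rho> \<circ> \<tau> \<in> S" if "\<tau> \<in> G" "\<rho> \<in> G" for \<tau> \<rho>
    using free[OF that] char_nonzero inv_in that assms(3) by auto
  have nonzero: "?t (\<alpha> \<circ> \<tau>) (e \<circ> (\<alpha> \<circ> \<rho>)) \<noteq> 0 \<longleftrightarrow> w (e \<circ> (\<alpha> \<circ> \<rho>)) \<noteq> 0" if "\<tau> \<in> G" "\<rho> \<in> G" for \<tau> \<rho>
  proof -
    obtain c where c: "\<forall>\<rho>\<in>G. ?t (\<alpha> \<circ> \<tau>) (e \<circ> (\<alpha> \<circ> \<rho>)) = c * w (e \<circ> (\<alpha> \<circ> \<rho>))"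
      using line \<open>\<tau> \<in> G\<close> by blast
    have "?t (\<alpha> \<circ> \<tau>) (e \<circ> (\<alpha> \<circ> \<tau>)) \<noteq> 0"
      using supp[OF that(1,1)] inv_comp[OF that(1)] assms(2) by simp
    with c that show ?thesis by (metis mult_eq_0_iff)
  qed
  \<comment> \<open>Compare the supports of the tensors of \<open>\<alpha> \<circ> g\<close> and of \<open>\<alpha>\<close> at the point \<open>\<alpha>\<close>.\<close>
  obtain g where g: "g \<in> G" "g \<notin> S" using assms(1) by blast
  have "inv' id \<circ> g \<in> S \<longleftrightarrow> inv' id \<circ> id \<in> S"
    using nonzero supp g(1) id_in by metis
  with g(2) assms(2) show False by simp
qed

end

section \<open>Regular elements of the semi-dihedral group\<close>

lemma SD_mult: "f \<otimes>\<^bsub>SD n\<^esub> g = f \<circ> g"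
  by (simp add: SD_def sym_group_mult)

lemma SD_one: "\<one>\<^bsub>SD n\<^esub> = id"
  by (simp add: SD_def sym_group_one)

lemma SD_pow: "f [^]\<^bsub>SD n\<^esub> (i::nat) = f ^^ i"
  by (induction i) (simp_all add: SD_mult SD_one funpow_Suc_right del: funpow.simps(2))

lemma SD_ord_dvd:
  assumes "n \<ge> 1" "f \<in> carrier (SD n)"
  shows "group.ord (SD n) f dvd i \<longleftrightarrow> f ^^ i = id"
  using group.pow_eq_id[OF SD_subgroup(2)[OF assms(1)] assms(2), of i] by (simp add: SD_pow SD_one)

lemma SD_cases:
  assumes "n \<ge> 1" "f \<in> carrier (SD n)"
  obtains i where "i < 4*n" "f = sd_a n ^^ i" | i where "i < 4*n" "f = sd_b n \<circ> sd_a n ^^ i"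
  using assms SD_carrier by blast

lemma SD_affine:
  assumes "n \<ge> 1" "f \<in> carrier (SD n)"
  shows "\<exists>s c. f = aff (4*n) s c"
  using assms(2)
  by (rule SD_cases[OF assms(1)]) (use assms(1) in \<open>auto simp: sd_a_pow sd_b_aff aff_comp\<close>)

lemma sd_a_in:
  assumes "n \<ge> 1"
  shows "sd_a n ^^ i \<in> carrier (SD n)"
proof -
  have "sd_a n ^^ i = sd_a n ^^ (i mod (4*n))"
    unfolding sd_a_pow[OF assms] by (rule aff_cong) simp_all
  moreover have "i mod (4*n) < 4*n" using assms by simp
  ultimately show ?thesis unfolding SD_carrier[OF assms] by blast
qed

text \<open>The square of \<open>b a\<^sup>i\<close> is a rotation by a multiple of \<open>2n\<close>, since \<open>b a\<^sup>i b = a\<^sup>(\<^sup>2\<^sup>n\<^sup>-\<^sup>1\<^sup>)\<^sup>i\<close>.\<close>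

lemma sd_b_a_pow_4:
  assumes "n \<ge> 1"
  shows "(sd_b n \<circ> sd_a n ^^ i) ^^ 4 = id"
proof -
  let ?m = "4*n" and ?s = "2*n - 1"
  define f where "f = sd_b n \<circ> sd_a n ^^ i"
  have m: "?m > 0" using assms by simp
  have "f = aff ?m ?s (?s * i)"
    unfolding f_def sd_a_pow[OF assms] sd_b_aff aff_comp[OF m] by simp
  then have "f \<circ> f = aff ?m 1 (?s * (?s * i) + ?s * i)"
    using aff_sd_sq[OF assms] by (simp only: aff_comp[OF m])
  also have "?s * (?s * i) + ?s * i = ?s * i * (2 * n)"
    using assms by (cases n) (auto simp: algebra_simps)
  finally have ff: "f \<circ> f = aff ?m 1 (?s * i * (2 * n))" .
  have "f ^^ 4 = (f \<circ> f) \<circ> (f \<circ> f)"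
    by (simp add: numeral_eq_Suc comp_assoc)
  also have "\<dots> = aff ?m 1 (?m * (?s * i))"
  proof -
    have "?s * i * (2 * n) + ?s * i * (2 * n) = ?m * (?s * i)" by simp
    then show ?thesis by (simp only: ff aff_comp[OF m] mult_1_left)
  qed
  also have "\<dots> = aff ?m 1 0" by (rule aff_cong) simp_all
  finally show ?thesis unfolding f_def aff_id .
qed

lemma sd_a_ord_dvd:
  assumes "n \<ge> 1"
  shows "4 * n dvd group.ord (SD n) (sd_a n)"
proof -
  let ?o = "group.ord (SD n) (sd_a n)"
  have "sd_a n ^^ ?o = id"
    using SD_ord_dvd[OF assms, of "sd_a n" ?o] sd_a_in[OF assms, of 1] by simp
  then have "aff (4*n) 1 ?o = aff (4*n) 1 0"
    unfolding sd_a_pow[OF assms] aff_id .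
  then have "?o mod (4*n) = 0 mod (4*n)"
    using assms by (intro aff_eq_imp(2)) auto
  then show ?thesis by (simp add: dvd_eq_mod_eq_0)
qed

lemma id_p_regular:
  assumes "n \<ge> 1" "prime p"
  shows "id \<in> p_regular p (SD n)"
proof -
  have "id \<in> carrier (SD n)" using sd_a_in[OF assms(1), of 0] by simp
  moreover from this have "group.ord (SD n) id dvd 1"
    by (subst SD_ord_dvd[OF assms(1)]) simp_all
  ultimately show ?thesis
    using assms(2) by (auto simp: p_regular_def)
qed

lemma sd_reflection_p_regular:
  assumes "n \<ge> 1" "prime p" "p \<noteq> 2" "i < 4 * n"
  shows "sd_b n \<circ> sd_a n ^^ i \<in> p_regular p (SD n)"
proof -
  let ?f = "sd_b n \<circ> sd_a n ^^ i"
  have f: "?f \<in> carrier (SD n)" unfolding SD_carrier[OF assms(1)] using assms(4) by blast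
  have "group.ord (SD n) ?f dvd 2 ^ 2"
    using SD_ord_dvd[OF assms(1) f, of 4] sd_b_a_pow_4[OF assms(1)] by simp
  then have "\<not> p dvd group.ord (SD n) ?f"
    using assms(2,3) by (metis dvd_trans prime_dvd_power primes_dvd_imp_eq two_is_prime_nat)
  with f show ?thesis by (simp add: p_regular_def)
qed

text \<open>The elements that are not \<open>p\<close>-regular are among \<open>a, \<dots>, a\<^sup>4\<^sup>n\<^sup>-\<^sup>1\<close>, so there are fewer than
  \<open>4n\<close> of them.\<close>

lemma card_p_regular_gt_half:
  assumes "n \<ge> 2" "prime p" "p \<noteq> 2"
  shows "card (carrier (SD n)) < 2 * card (p_regular p (SD n))"
proof -
  let ?G = "carrier (SD n)" and ?S = "p_regular p (SD n)"
  have n: "n \<ge> 1" using assms(1) by simp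
  have card_G: "card ?G = 8 * n" using SD_order[OF assms(1)] by (simp add: order_def)
  then have fin: "finite ?G" using assms(1) by (metis card.infinite mult_is_0 not_numeral_le_zero zero_neq_numeral)
  have sub: "?S \<subseteq> ?G" by (auto simp: p_regular_def)
  have "?G - ?S \<subseteq> (\<lambda>i. sd_a n ^^ i) ` {1..<4*n}"
  proof
    fix f assume f: "f \<in> ?G - ?S"
    then have "f \<in> ?G" by blast
    then show "f \<in> (\<lambda>i. sd_a n ^^ i) ` {1..<4*n}"
    proof (rule SD_cases[OF n])
      fix i assume i: "i < 4 * n" "f = sd_a n ^^ i"
      then have "i \<noteq> 0" using f id_p_regular[OF n assms(2)] by (metis DiffD2 funpow_0 id_apply ext)
      with i show ?thesis by auto
    next
      fix i assume "i < 4 * n" "f = sd_b n \<circ> sd_a n ^^ i"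
      then show ?thesis using f sd_reflection_p_regular[OF n assms(2,3)] by blast
    qed
  qed
  then have "card (?G - ?S) \<le> card {1..<4*n}"
    by (meson card_image_le card_mono finite_atLeastLessThan finite_imageI le_trans)
  moreover have "card (?G - ?S) = card ?G - card ?S"
    by (rule card_Diff_subset[OF finite_subset[OF sub fin] sub])
  ultimately show ?thesis using card_G assms(1) by simp
qed

lemma linear_character_SD:
  assumes "linear_character (SD n) \<chi>" "\<sigma> \<in> carrier (SD n)"
  shows linear_character_comp: "\<tau> \<in> carrier (SD n) \<Longrightarrow> \<chi> (\<sigma> \<circ> \<tau>) = \<chi> \<sigma> * \<chi> \<tau>"
    and linear_character_nonzero: "\<chi> \<sigma> \<noteq> 0"
proof -
  let ?H = "\<lparr>carrier = UNIV - {0::complex}, mult = (*), one = 1\<rparr>"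
  have hom: "\<chi> \<in> hom (SD n) ?H" using assms(1) unfolding linear_character_def .
  show "\<chi> (\<sigma> \<circ> \<tau>) = \<chi> \<sigma> * \<chi> \<tau>" if "\<tau> \<in> carrier (SD n)"
    using hom_mult[OF hom assms(2) that] by (simp add: SD_mult)
  show "\<chi> \<sigma> \<noteq> 0" using hom assms(2) by (auto simp: hom_def)
qed

lemma linear_character_funpow:
  assumes "n \<ge> 1" "linear_character (SD n) \<chi>" "\<sigma> \<in> carrier (SD n)"
  shows "\<chi> (\<sigma> ^^ i) = \<chi> \<sigma> ^ i"
proof -
  interpret group "SD n" by (rule SD_subgroup(2)[OF assms(1)])
  have in_G: "\<sigma> ^^ i \<in> carrier (SD n)" for i
    using nat_pow_closed[OF assms(3), of i] by (simp add: SD_pow)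
  note comp = linear_character_comp[OF assms(2)] and nonzero = linear_character_nonzero[OF assms(2)]
  show ?thesis
  proof (induction i)
    case 0
    have "id \<in> carrier (SD n)" using in_G[of 0] by (simp only: funpow.simps)
    then have "\<chi> id = \<chi> id * \<chi> id" "\<chi> id \<noteq> 0" using comp[of id id] nonzero by simp_all
    then have "\<chi> id = 1" by simp
    then show ?case by (simp only: funpow.simps power_0)
  next
    case (Suc i)
    then show ?case using comp[OF assms(3) in_G] by (simp only: funpow.simps power_Suc)
  qed
qed

text \<open>The character with values \<open>(1, -1)\<close> on \<open>(a, b)\<close> is \<open>-1\<close> at every \<open>b a\<^sup>i\<close>, which therefore has even
  order.\<close>

lemma two_regular_is_rotation:
  assumes "n \<ge> 2" "f \<in> p_regular 2 (SD n)"
  shows "\<exists>i. f = sd_a n ^^ i"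
proof -
  have n: "n \<ge> 1" using assms(1) by simp
  have f: "f \<in> carrier (SD n)" "odd (group.ord (SD n) f)"
    using assms(2) by (auto simp: p_regular_def)
  have "1 \<le> (if even n then 3 else 7 :: nat)" by simp
  then obtain \<chi> where "is_sd_char n 1 \<chi>" using is_sd_char_exists[OF assms(1)] by blast
  then have \<chi>: "linear_character (SD n) \<chi>" "\<chi> (sd_a n) = 1" "\<chi> (sd_b n) = -1"
    by (auto simp: is_sd_char_def sd_char_values_def split: if_splits)
  note pow = linear_character_funpow[OF n \<chi>(1)]
  from f(1) show ?thesis
  proof (rule SD_cases[OF n])
    fix i assume i: "i < 4 * n" "f = sd_b n \<circ> sd_a n ^^ i"
    have a: "sd_a n \<in> carrier (SD n)" using sd_a_in[OF n, of 1] by simp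
    have b: "sd_b n \<in> carrier (SD n)"
      unfolding SD_carrier[OF n] using n by (intro UnI2 CollectI exI[of _ 0]) simp
    have "\<chi> f = -1"
      unfolding i(2) using linear_character_comp[OF \<chi>(1) b sd_a_in[OF n]] pow[OF a] \<chi> by simp
    moreover have "\<chi> f ^ group.ord (SD n) f = 1"
      using pow[OF f(1), of "group.ord (SD n) f"] pow[OF f(1), of 0] SD_ord_dvd[OF n f(1), of "group.ord (SD n) f"]
      by simp
    ultimately show ?thesis using f(2) by simp
  qed blast
qed

text \<open>Elements of odd order are powers of \<open>a\<close>, hence commute, and then the order of a product divides the
  product of the orders.\<close>

lemma two_regular_subgroup:
  assumes "n \<ge> 2"
  shows "subgroup (p_regular 2 (SD n)) (SD n)"
proof -
  have n: "n \<ge> 1" using assms by simp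
  interpret group "SD n" by (rule SD_subgroup(2)[OF n])
  show ?thesis
  proof (rule subgroupI)
    show "p_regular 2 (SD n) \<subseteq> carrier (SD n)" by (auto simp: p_regular_def)
    show "p_regular 2 (SD n) \<noteq> {}" using id_p_regular[OF n two_is_prime_nat] by blast
  next
    fix f assume f: "f \<in> p_regular 2 (SD n)"
    have "f [^]\<^bsub>SD n\<^esub> ord f = \<one>\<^bsub>SD n\<^esub>" "f \<in> carrier (SD n)"
      using f by (auto simp: p_regular_def)
    then have "ord (inv\<^bsub>SD n\<^esub> f) dvd ord f"
      using pow_eq_id[of "inv\<^bsub>SD n\<^esub> f" "ord f"] nat_pow_inv[of f "ord f"] by simp
    then show "inv\<^bsub>SD n\<^esub> f \<in> p_regular 2 (SD n)"
      using f by (auto simp: p_regular_def)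
  next
    fix f g assume fg: "f \<in> p_regular 2 (SD n)" "g \<in> p_regular 2 (SD n)"
    then have carr: "f \<in> carrier (SD n)" "g \<in> carrier (SD n)" and odd: "odd (ord f * ord g)"
      by (auto simp: p_regular_def)
    obtain i j where "f = sd_a n ^^ i" "g = sd_a n ^^ j"
      using two_regular_is_rotation[OF assms] fg by metis
    then have "f \<otimes>\<^bsub>SD n\<^esub> g = g \<otimes>\<^bsub>SD n\<^esub> f"
      unfolding SD_mult by (metis add.commute funpow_add)
    then have "(f \<otimes>\<^bsub>SD n\<^esub> g) [^]\<^bsub>SD n\<^esub> (ord f * ord g)
        = f [^]\<^bsub>SD n\<^esub> (ord f * ord g) \<otimes>\<^bsub>SD n\<^esub> g [^]\<^bsub>SD n\<^esub> (ord f * ord g)"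
      using pow_mult_distrib carr by blast
    also have "\<dots> = \<one>\<^bsub>SD n\<^esub>"
      using carr pow_eq_id[of f "ord f * ord g"] pow_eq_id[of g "ord f * ord g"] by simp
    finally have "ord (f \<otimes>\<^bsub>SD n\<^esub> g) dvd ord f * ord g"
      using pow_eq_id carr by blast
    then show "f \<otimes>\<^bsub>SD n\<^esub> g \<in> p_regular 2 (SD n)"
      using odd carr unfolding p_regular_def by (auto dest: dvd_trans)
  qed
qed

lemma p_regular_subgroup:
  assumes "n \<ge> 2" "prime p" "p = 2 \<or> \<not> p dvd 4 * n"
  shows "subgroup (p_regular p (SD n)) (SD n)"
proof (cases "p = 2")
  case True
  then show ?thesis using two_regular_subgroup[OF assms(1)] by simp
next
  case False
  interpret group "SD n" using SD_subgroup(2) assms(1) by simp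
  have "\<not> p dvd 2 * (4 * n)"
    using False assms(2,3) prime_dvd_mult_iff[OF assms(2)] primes_dvd_imp_eq[OF assms(2) two_is_prime_nat]
    by blast
  then have "\<not> p dvd ord f" if "f \<in> carrier (SD n)" for f
    using ord_dvd_group_order[OF that] SD_order[OF assms(1)] dvd_trans by auto
  then have "p_regular p (SD n) = carrier (SD n)" by (auto simp: p_regular_def)
  then show ?thesis by (simp add: subgroup_self)
qed

definition marking :: "nat \<Rightarrow> nat \<Rightarrow> nat" where
  "marking m = (\<lambda>t\<in>{1..m}. if t = 1 then 1 else if t = 2 then 2 else 3)"

lemma marking_in_seqs: "k > 2 \<Longrightarrow> marking m \<in> seqs m k"
  by (auto simp: marking_def seqs_def)

text \<open>Only the points 1 and 2 can be recovered from their values; the bound \<open>u \<le> 2\<close> expresses this.\<close>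

lemma marking_eq_imp:
  assumes "marking m t = marking m u" "t \<in> {1..m}" "u \<in> {1..m}" "u \<le> 2"
  shows "t = u"
proof -
  have val: "marking m x = (if x = 1 then 1 else if x = 2 then 2 else 3)" if "x \<in> {1..m}" for x
    unfolding marking_def using that by (simp only: restrict_apply if_True)
  have "u = 1 \<or> u = 2" using assms(3,4) by auto
  then show ?thesis
    using assms(1) unfolding val[OF assms(2)] val[OF assms(3)]
    by (metis numeral_eq_iff num.distinct one_eq_numeral_iff)
qed

text \<open>The points 1 and 2 differ by 1, so the difference of their images is the slope \<open>s\<close> modulo \<open>m\<close>.\<close>

lemma affine_fixing_two_points:
  assumes "m > 2" "aff m s c 1 = 1" "aff m s c 2 = 2"
  shows "aff m s c = id"
proof -
  have "red m (s * 1 + c) = 1" "red m (s * 2 + c) = 2"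
    using assms by (simp_all add: aff_def)
  then have "[s + c = 1] (mod m)" "[s * 2 + c = 1 + 1] (mod m)"
    unfolding cong_def one_add_one by (metis mult_1_right red_mod)+
  moreover have "[s + (s + c) = s + 1] (mod m)"
    by (rule cong_add) (use calculation in auto)
  ultimately have s: "[s = 1] (mod m)"
    by (metis add.assoc cong_add_rcancel_nat cong_sym cong_trans mult_2_right)
  then have "[1 + c = s + c] (mod m)" by (intro cong_add cong_sym[OF s] cong_refl)
  then have "[c = 0] (mod m)"
    using \<open>[s + c = 1] (mod m)\<close> by (metis add_0_right cong_add_lcancel_nat cong_trans)
  with s have "aff m s c = aff m 1 0"
    by (intro aff_cong) (simp_all add: cong_def)
  then show ?thesis unfolding aff_id .
qed

lemma marking_stabilizer:
  assumes "n \<ge> 1" "\<sigma> \<in> carrier (SD n)" "marking (4*n) \<circ> \<sigma> = marking (4*n)"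
  shows "\<sigma> = id"
proof -
  have perm: "\<sigma> permutes {1..4*n}"
    using subgroup.subset[OF SD_subgroup(1)[OF assms(1)]] assms(2) by (auto simp: sym_group_carrier)
  have im: "\<sigma> t \<in> {1..4*n}" if "t \<in> {1..4*n}" for t
    unfolding permutes_in_image[OF perm] by (rule that)
  have eq: "marking (4*n) (\<sigma> t) = marking (4*n) t" for t
    using fun_cong[OF assms(3)] by simp
  have "\<sigma> 1 = 1" "\<sigma> 2 = 2"
    using assms(1) by (intro marking_eq_imp[OF eq] im; simp)+
  moreover obtain s c where "\<sigma> = aff (4*n) s c" using SD_affine[OF assms(1,2)] by blast
  ultimately show ?thesis using affine_fixing_two_points[of "4*n" s c] assms(1) by simp
qed

theorem theorem7p1:
  fixes n p j k :: nat
    and scale :: "complex \<Rightarrow> 'v::ab_group_add \<Rightarrow> 'v"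
    and ip :: "'v \<Rightarrow> 'v \<Rightarrow> complex"
    and e :: "nat \<Rightarrow> 'v"
    and \<chi> \<phi> :: "(nat \<Rightarrow> nat) \<Rightarrow> complex"
  assumes "n \<ge> 2"
    and "prime p"
    and "complex_inner_space scale ip"
    and "k = vector_space.dim scale (UNIV :: 'v set)"
    and "k > 2"
    and "orthonormal_basis scale ip k e"
    and "j \<le> sd_eps p n"
    and "is_sd_char n j \<chi>"
    and "\<phi> = restrict \<chi> (p_regular p (SD n))"
  shows "(\<exists>B. o_basis ip k e (4*n) (p_regular p (SD n)) \<phi>
              (symmetry_class ip k e (4*n) (p_regular p (SD n)) \<phi>) B)
         \<longleftrightarrow> p = 2 \<or> \<not> p dvd 4 * n"
proof -
  let ?G = "carrier (SD n)" and ?S = "p_regular p (SD n)"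
  have n: "n \<ge> 1" using assms(1) by simp
  interpret complex_inner_space scale ip by (rule assms(3))
  have \<chi>: "linear_character (SD n) \<chi>" using assms(8) by (simp add: is_sd_char_def)
  have sub: "?S \<subseteq> ?G" by (auto simp: p_regular_def)
  have \<phi>: "\<phi> \<sigma> = \<chi> \<sigma>" if "\<sigma> \<in> ?S" for \<sigma> using that assms(9) by simp
  show ?thesis
  proof (cases "p = 2 \<or> \<not> p dvd 4 * n")
    case True
    interpret S: subgroup ?S "SD n" by (rule p_regular_subgroup[OF assms(1,2) True])
    have comp: "\<sigma> \<circ> \<tau> \<in> ?S" if "\<sigma> \<in> ?S" "\<tau> \<in> ?S" for \<sigma> \<tau>
      using S.m_closed[OF that] by (simp add: SD_mult)
    have "subgroup ?S (sym_group (4*n))"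
      using group.incl_subgroup[OF sym_group_is_group SD_subgroup(1)[OF n]] S.subgroup_axioms
      by (simp add: SD_def)
    then interpret permutation_character scale ip k "4*n" e ?S \<phi>
      using assms(3,6) comp \<phi> sub linear_character_comp[OF \<chi>] linear_character_nonzero[OF \<chi>]
      by (intro permutation_character.intro permutation_character_axioms.intro) (auto simp: subset_iff)
    show ?thesis using o_basis_exists True by simp
  next
    case False
    interpret permutation_character scale ip k "4*n" e ?G \<chi>
      using assms(3,6) SD_subgroup(1)[OF n] linear_character_comp[OF \<chi>] linear_character_nonzero[OF \<chi>]
      by (intro permutation_character.intro permutation_character_axioms.intro) auto
    \<comment> \<open>The order of \<open>a\<close> is a multiple of \<open>4n\<close>, hence of \<open>p\<close>, so \<open>S\<close> is a proper subset of \<open>G\<close>.\<close>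
    have "sd_a n \<in> ?G" using sd_a_in[OF n, of 1] by simp
    moreover have "sd_a n \<notin> ?S"
      using False sd_a_ord_dvd[OF n] dvd_trans by (auto simp: p_regular_def)
    ultimately have "?S \<subset> ?G" using sub by blast
    moreover have "card ?G < 2 * card ?S"
      using card_p_regular_gt_half[OF assms(1,2)] False by simp
    ultimately have "\<not> o_basis ip k e (4*n) ?S \<phi> (symmetry_class ip k e (4*n) ?S \<phi>) B" for B
      using id_p_regular[OF n assms(2)] marking_in_seqs[OF assms(5)] marking_stabilizer[OF n] \<phi>
      by (intro no_o_basis) auto
    with False show ?thesis by simp
  qed
qed

end
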